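(* Let $(X,\tau)$ be a metrizable space with $\dim(X,\tau)=n$, where $n\geq 0$ is an integer. Then there exist subsets $M_1,\dots,M_{n+1}$ of $X$ such that (i) $\tau=\bigcap_{i=1}^{n+1}\tau(M_i)$, and (ii) each space $(X,\tau(M_i))$, $i=1,\dots,n+1$, is metrizable and $\dim(X,\tau(M_i))=0$. In particular, $1\leq \mathrm{Sn}^{\mathcal M_{\dim}}(X,\tau)\leq n+1$. Moreover, if $\dim(X,\tau)\geq 1$, then $2\leq \mathrm{Sn}^{\mathcal M_{\dim}}(X,\tau)\leq n+1$.
   Context: For a topological space $(X,\tau)$ and $M\subseteq X$, $\tau(M)=\{U\cup K : U\in\tau,\ K\subseteq X\setminus M\}$, a topology on $X$ containing $\tau$. Covering dimension: for a normal space $X$, $\dim X=-1$ iff $X=\emptyset$; $\dim X\le n$ ($n\ge 0$) if every finite open cover of $X$ has a finite open refinement covering $X$ in which any $n+2$ distinct elements have empty intersection; $\dim X=n$ if $\dim X\le n$ but not $\dim X\le n-1$; $\dim X=\infty$ if $\dim X\le n$ for no $n$. $\mathcal M_{\dim}$ is the class of metrizable spaces $Z$ with $\dim Z=0$. Structural number: for a class $\mathcal A$ of topological spaces, $\mathrm{Sn}^{\mathcal A}(X,\tau)$ is the smallest cardinal $\kappa$ for which there is a (nonempty) family $\tau_i$, $i\in I$, of topologies on $X$ with $\tau\subseteq\tau_i$ and $(X,\tau_i)\in\mathcal A$ for all $i$, $|I|=\kappa$, and $\tau=\bigcap_{i\in I}\tau_i$; if there is no such family, $\mathrm{Sn}^{\mathcal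 A}(X,\tau)=\infty$, where $\infty$ is larger than every cardinal. *)

theory Defs
  imports "HOL-Analysis.Analysis"
begin

unbundle cardinal_syntax

text \<open>\<open>\<tau>(M)\<close>: the points outside \<open>M\<close> become isolated.\<close>

definition discretize_off :: "'a topology \<Rightarrow> 'a set \<Rightarrow> 'a topology" where
  "discretize_off X M =
     topology (\<lambda>S. \<exists>U K. openin X U \<and> K \<subseteq> topspace X - M \<and> S = U \<union> K)"

lemma openin_discretize_off:
  "openin (discretize_off X M) S \<longleftrightarrow>
     (\<exists>U K. openin X U \<and> K \<subseteq> topspace X - M \<and> S = U \<union> K)"
proof -
  let ?P = "\<lambda>S. \<exists>U K. openin X U \<and> K \<subseteq> topspace X - M \<and> S = U \<union> K"
  have "istopology ?P"
    unfolding istopology_def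
  proof (intro conjI allI impI)
    fix S T assume "?P S" and "?P T"
    then obtain U K V L where
      U: "openin X U" and K: "K \<subseteq> topspace X - M" and S: "S = U \<union> K" and
      V: "openin X V" and L: "L \<subseteq> topspace X - M" and T: "T = V \<union> L"
      by blast
    have "S \<inter> T = (U \<inter> V) \<union> ((S \<inter> T) \<inter> (K \<union> L))" using S T by blast
    moreover have "openin X (U \<inter> V)" using U V by blast
    moreover have "(S \<inter> T) \<inter> (K \<union> L) \<subseteq> topspace X - M" using K L by blast
    ultimately show "?P (S \<inter> T)" by blast
  next
    fix \<K> assume *: "\<forall>S\<in>\<K>. ?P S"
    then obtain U K where
      UK: "\<And>S. S \<in> \<K> \<Longrightarrow> openin X (U S) \<and> K S \<subseteq> topspace X - M \<and> S = U S \<union> K S"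
      by metis
    have "\<Union>\<K> = (\<Union>S\<in>\<K>. U S) \<union> (\<Union>S\<in>\<K>. K S)" using UK by blast
    moreover have "openin X (\<Union>S\<in>\<K>. U S)" using UK by blast
    moreover have "(\<Union>S\<in>\<K>. K S) \<subseteq> topspace X - M" using UK by blast
    ultimately show "?P (\<Union>\<K>)" by blast
  qed
  then show ?thesis
    by (simp add: discretize_off_def topology_inverse')
qed

lemma topspace_discretize_off [simp]: "topspace (discretize_off X M) = topspace X"
proof (rule antisym)
  show "topspace (discretize_off X M) \<subseteq> topspace X"
    using openin_topspace[of "discretize_off X M"] openin_subset[of X]
    unfolding openin_discretize_off by blast
  have "openin (discretize_off X M) (topspace X)"
    unfolding openin_discretize_off by (metis empty_subsetI openin_topspace sup_bot_right)
  then show "topspace X \<subseteq> topspace (discretize_off X M)" by (rule openin_subset)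
qed

definition finite_open_cover :: "'a topology \<Rightarrow> 'a set set \<Rightarrow> bool" where
  "finite_open_cover X \<U> \<longleftrightarrow> finite \<U> \<and> (\<forall>U\<in>\<U>. openin X U) \<and> \<Union>\<U> = topspace X"

text \<open>Usually defined for normal spaces only; the definitions below make sense for every
  topological space and are used here for metrizable ones. This is the Lebesgue covering dimension,
  not the small inductive dimension \<open>dim_le\<close> of \<open>HOL-Analysis.Locally\<close>.\<close>

definition covering_dim_le :: "'a topology \<Rightarrow> int \<Rightarrow> bool" where
  "covering_dim_le X n \<longleftrightarrow>
     (if n < 0 then n = - 1 \<and> topspace X = {}
      else \<forall>\<U>. finite_open_cover X \<U> \<longrightarrow>
             (\<exists>\<V>. finite_open_cover X \<V> \<and> (\<forall>V\<in>\<V>. \<exists>U\<in>\<U>. V \<subseteq> U) \<and>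
                  (\<forall>\<W>\<subseteq>\<V>. card \<W> = nat n + 2 \<longrightarrow> \<Inter>\<W> = {})))"

definition covering_dim :: "'a topology \<Rightarrow> ereal" where
  "covering_dim X =
     (if \<exists>n. covering_dim_le X n
      then ereal (of_int (THE n. covering_dim_le X n \<and> \<not> covering_dim_le X (n - 1)))
      else \<infinity>)"

lemma covering_dim_le_Suc:
  assumes "covering_dim_le X n" shows "covering_dim_le X (n + 1)"
proof (cases "n < 0")
  case True
  then have n: "n = - 1" and X: "topspace X = {}"
    using assms by (auto simp: covering_dim_le_def split: if_splits)
  have "finite_open_cover X {}" using X by (simp add: finite_open_cover_def)
  moreover have "(\<forall>V\<in>{}. \<exists>U\<in>\<U>. V \<subseteq> U) \<and> (\<forall>\<W>\<subseteq>{}. card \<W> = nat 0 + 2 \<longrightarrow> \<Inter>\<W> = {})"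
    for \<U> :: "'a set set" by simp
  ultimately have "covering_dim_le X 0"
    unfolding covering_dim_le_def by (metis less_irrefl)
  then show ?thesis using n by simp
next
  case False
  have "\<exists>\<V>. finite_open_cover X \<V> \<and> (\<forall>V\<in>\<V>. \<exists>U\<in>\<U>. V \<subseteq> U) \<and>
          (\<forall>\<W>\<subseteq>\<V>. card \<W> = nat (n + 1) + 2 \<longrightarrow> \<Inter>\<W> = {})"
    if U: "finite_open_cover X \<U>" for \<U>
  proof -
    obtain \<V> where V: "finite_open_cover X \<V>" "\<forall>V\<in>\<V>. \<exists>U\<in>\<U>. V \<subseteq> U"
      and W: "\<And>\<W>. \<W> \<subseteq> \<V> \<Longrightarrow> card \<W> = nat n + 2 \<Longrightarrow> \<Inter>\<W> = {}"
      using assms False U unfolding covering_dim_le_def by auto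
    have "\<Inter>\<W> = {}" if WV: "\<W> \<subseteq> \<V>" and c: "card \<W> = nat (n + 1) + 2" for \<W>
    proof -
      have "nat n + 2 \<le> card \<W>" using c False by linarith
      then obtain \<W>' where "\<W>' \<subseteq> \<W>" "card \<W>' = nat n + 2"
        using obtain_subset_with_card_n by metis
      with W[of \<W>'] WV show ?thesis by blast
    qed
    with V show ?thesis by blast
  qed
  then show ?thesis
    using False unfolding covering_dim_le_def by simp
qed

lemma covering_dim_le_mono:
  assumes "covering_dim_le X m" "m \<le> n" shows "covering_dim_le X n"
  using assms(2,1) by (induction n rule: int_ge_induct) (auto intro: covering_dim_le_Suc)

lemma covering_dim_eq_iff:
  "covering_dim X = ereal (of_int n) \<longleftrightarrow>
     covering_dim_le X n \<and> \<not> covering_dim_le X (n - 1)"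
proof -
  let ?Q = "\<lambda>n. covering_dim_le X n \<and> \<not> covering_dim_le X (n - 1)"
  have uniq: "k = m" if "?Q k" "?Q m" for k m
    using that covering_dim_le_mono[of X k "m - 1"] covering_dim_le_mono[of X m "k - 1"]
    by (metis linorder_neqE zle_diff1_eq)
  have ex: "\<exists>m. ?Q m" if "covering_dim_le X k" for k
  proof (rule ccontr)
    assume "\<nexists>m. ?Q m"
    then have "covering_dim_le X (k - int j)" for j
      using that by (induction j) (auto simp: algebra_simps)
    from this[of "nat (k + 2)"] show False
      using that by (cases "k \<ge> - 2") (auto simp: covering_dim_le_def split: if_splits)
  qed
  have the: "(THE n. ?Q n) = m" if "?Q m" for m
    using that uniq by (intro the_equality) blast+
  show ?thesis
  proof (cases "\<exists>k. covering_dim_le X k")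
    case True
    then obtain m where m: "?Q m" using ex by blast
    have "covering_dim X = ereal (of_int m)"
      using True the[OF m] unfolding covering_dim_def by presburger
    then have "covering_dim X = ereal (of_int n) \<longleftrightarrow> m = n" by simp
    also have "\<dots> \<longleftrightarrow> ?Q n" using m uniq by blast
    finally show ?thesis .
  next
    case False
    then show ?thesis by (simp add: covering_dim_def)
  qed
qed

text \<open>Cardinals are those of \<open>BNF_Cardinal_Order_Relation\<close>, compared by \<open>\<le>o\<close>;
  \<open>None\<close> plays the role of the additional value \<open>\<infinity>\<close>.\<close>

definition xcard_le :: "'b rel option \<Rightarrow> 'c rel option \<Rightarrow> bool" where
  "xcard_le \<kappa> \<mu> \<longleftrightarrow>
     (case \<mu> of None \<Rightarrow> True
      | Some m \<Rightarrow> (case \<kappa> of None \<Rightarrow> False | Some k \<Rightarrow> k \<le>o m))"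

definition xcard_of_nat :: "nat \<Rightarrow> nat rel option" where
  "xcard_of_nat n = Some |{..<n}|"

definition structural_family ::
    "('a topology \<Rightarrow> bool) \<Rightarrow> 'a topology \<Rightarrow> 'i set \<Rightarrow> ('i \<Rightarrow> 'a topology) \<Rightarrow> bool" where
  "structural_family \<A> X I T \<longleftrightarrow>
     I \<noteq> {} \<and>
     (\<forall>i\<in>I. topspace (T i) = topspace X \<and>
            Collect (openin X) \<subseteq> Collect (openin (T i)) \<and> \<A> (T i)) \<and>
     Collect (openin X) = (\<Inter>i\<in>I. Collect (openin (T i)))"

text \<open>The smallest cardinal \<open>|I|\<close> of such a family. Index sets are drawn from the type \<^typ>\<open>'a topology\<close>. This loses nothing, because a family
  can be re-indexed by its range; see \<open>structural_number_le\<close> below, where the index type is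
  arbitrary. The minimal cardinal is unique up to \<open>=o\<close>.\<close>

definition structural_number :: "('a topology \<Rightarrow> bool) \<Rightarrow> 'a topology \<Rightarrow> 'a topology rel option" where
  "structural_number \<A> X =
     (if \<exists>I T. structural_family \<A> X (I :: 'a topology set) T
      then Some (SOME \<kappa>.
        (\<exists>I. (\<exists>T. structural_family \<A> X (I :: 'a topology set) T) \<and> \<kappa> = |I| ) \<and>
        (\<forall>I. (\<exists>T. structural_family \<A> X (I :: 'a topology set) T) \<longrightarrow> \<kappa> \<le>o |I| ))
      else None)"

lemma structural_number_Some:
  assumes "structural_family \<A> X (J :: 'a topology set) S"
  obtains I T where "structural_family \<A> X (I :: 'a topology set) T"
    and "structural_number \<A> X = Some |I|"
    and "\<And>J S. structural_family \<A> X (J :: 'a topology set) S \<Longrightarrow> |I| \<le>o |J|"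
proof -
  let ?F = "\<lambda>I. \<exists>T. structural_family \<A> X (I :: 'a topology set) T"
  let ?P = "\<lambda>\<kappa>. (\<exists>I. ?F I \<and> \<kappa> = |I| ) \<and> (\<forall>I. ?F I \<longrightarrow> \<kappa> \<le>o |I| )"
  have "card_of ` Collect ?F \<noteq> {}" using assms by blast
  moreover have "\<forall>r\<in>card_of ` Collect ?F. Card_order r" using card_of_Card_order by blast
  ultimately have "\<exists>r\<in>card_of ` Collect ?F. \<forall>r'\<in>card_of ` Collect ?F. r \<le>o r'"
    by (rule exists_minim_Card_order)
  then have "\<exists>\<kappa>. ?P \<kappa>" by blast
  then have P: "?P (SOME \<kappa>. ?P \<kappa>)" by (rule someI_ex)
  define k where "k = (SOME \<kappa>. ?P \<kappa>)"
  have eq: "structural_number \<A> X = Some k"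
    unfolding structural_number_def k_def using assms by auto
  have Pk: "?P k" using P unfolding k_def .
  then obtain I where "?F I" and I: "k = |I|" by blast
  then obtain T where T: "structural_family \<A> X I T" by blast
  show ?thesis
  proof (rule that[OF T])
    show "structural_number \<A> X = Some |I|" unfolding eq I ..
    show "|I| \<le>o |J|" if "structural_family \<A> X J S" for J :: "'a topology set" and S
      using Pk that unfolding I by blast
  qed
qed

lemma structural_number_le:
  assumes "structural_family \<A> X J S"
  shows "xcard_le (structural_number \<A> X) (Some |J| )"
proof -
  have fam: "structural_family \<A> X (S ` J) id"
    using assms unfolding structural_family_def by auto
  show ?thesis
  proof (rule structural_number_Some[OF fam])
    fix I T
    assume I: "structural_number \<A> X = Some |I|"
      and le: "\<And>J S. structural_family \<A> X (J :: 'a topology set) S \<Longrightarrow> |I| \<le>o |J|"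
    have "|I| \<le>o |J|"
      by (rule ordLeq_transitive[OF le[OF fam] card_of_image])
    then show "xcard_le (structural_number \<A> X) (Some |J| )"
      by (simp add: I xcard_le_def)
  qed
qed

definition M_dim :: "'a topology \<Rightarrow> bool" where
  "M_dim Z \<longleftrightarrow> metrizable_space Z \<and> covering_dim Z = 0"

end

theory Submission
  imports Defs
begin

text \<open>Suppose that for every \<open>m\<close> there is a disjoint family of open sets of diameter at most \<open>1 / (m + 1)\<close>
such that \<open>M\<close> is the intersection of the unions of these families. Then \<open>\<tau>(M)\<close> is metrizable and zero-dimensional:
labelling a point by the member that contains it, and by itself if there is none, yields a sequence of
locally constant functions on \<open>\<tau>(M)\<close> that generates an ultrametric
(\<open>zero_dim_in_enlarge\<close>, \<open>metrizable_space_labels\<close>). Disjoint relatively open families in a subset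
\<open>K\<close> of a metrizable space extend to disjoint open families of the whole space. Hence every
zero-dimensional \<open>K\<close> lies in a suitable \<open>M\<close>, and it remains to write \<open>X\<close> as a union of \<open>n + 1\<close>
zero-dimensional subsets: if the \<open>M\<^sub>i\<close> cover \<open>X\<close>, a set that is open for every \<open>\<tau>(M\<^sub>i)\<close> is a
\<open>\<tau>\<close>-neighbourhood of each of its points.

This decomposition is the substance of the theorem. Paracompactness (\<open>metrizable_locally_finite_refinement\<close>)
and Dowker's passage from finite to locally finite covers (\<open>locally_finite_shrinking\<close>) yield locally
finite open covers \<open>\<U>\<^sub>0, \<U>\<^sub>1, \<dots>\<close> of order at most \<open>n + 1\<close> with mesh tending to zero, in which
the closure of every member of \<open>\<U>\<^sub>k\<^sub>+\<^sub>1\<close> lies in a chosen parent in \<open>\<U>\<^sub>k\<close>. A member \<open>s\<close> of this tree has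
a core: the points that lie in descendants of \<open>s\<close> of every generation. Cores are closed, and the core of \<open>s\<close>
is the union of the cores of its children. So the number of cores of level \<open>k\<close> that contain \<open>x\<close> lies between
\<open>1\<close> and \<open>n + 1\<close>, increases with \<open>k\<close>, and is upper semicontinuous in \<open>x\<close>. Let \<open>K\<^sub>j\<close> consist of the points where the
limit of this number is \<open>j\<close>. The points of \<open>K\<^sub>j\<close> where the value \<open>j\<close> is reached at level \<open>k\<close> form a closed
subset of \<open>K\<^sub>j\<close>. On it, the set of cores of any level from \<open>k\<close> on that contain \<open>x\<close> is locally constant in \<open>x\<close>,
since it can only shrink near \<open>x\<close> and has constant size; thus this subset is zero-dimensional. By the countable sum theorem
(\<open>zero_dim_in_countable_sum\<close>) so is \<open>K\<^sub>j\<close>.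

The bounds for the structural number follow: the \<open>\<tau>(M\<^sub>i)\<close> are a family of at most \<open>n + 1\<close>
topologies, and a family with a single member would consist of \<open>\<tau>\<close> itself, which is impossible for positive dimension.\<close>

section \<open>Locally constant selections and dimension zero\<close>

definition locally_constant_on :: "'a topology \<Rightarrow> 'a set \<Rightarrow> ('a \<Rightarrow> 'b) \<Rightarrow> bool" where
  "locally_constant_on X A c \<longleftrightarrow>
     (\<forall>x\<in>A. \<exists>U. openin X U \<and> x \<in> U \<and> (\<forall>y\<in>U \<inter> A. c y = c x))"

text \<open>The subspace \<open>A\<close> is strongly zero-dimensional in the form that suits paracompact spaces: every open cover has
a refinement by disjoint relatively open sets. The refinement is given by a selection \<open>c\<close> whose
fibres are its members, so that disjointness needs no separate treatment.\<close>

definition zero_dim_in :: "'a topology \<Rightarrow> 'a set \<Rightarrow> bool" where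
  "zero_dim_in X A \<longleftrightarrow>
     (\<forall>\<O>. (\<forall>U\<in>\<O>. openin X U) \<longrightarrow> A \<subseteq> \<Union>\<O> \<longrightarrow>
        (\<exists>c. locally_constant_on X A c \<and> (\<forall>x\<in>A. x \<in> c x \<and> c x \<in> \<O>)))"

text \<open>Disjoint relatively open sets of a subspace extend to disjoint open sets: give the label of \<open>x\<close> to a ball
around \<open>x\<close> with half the radius on which the label is constant. Of two centres whose balls meet, one lies
in the constancy ball of the other, so the labels do not clash.\<close>

lemma locally_constant_on_extend:
  fixes X :: "'a topology" and c :: "'a \<Rightarrow> 'b"
  assumes X: "metrizable_space X" and c: "locally_constant_on X A c"
  obtains c' where "\<And>x. x \<in> A \<Longrightarrow> c' x = c x"
    and "\<And>x. x \<in> A \<Longrightarrow> \<exists>U. openin X U \<and> x \<in> U \<and> (\<forall>y\<in>U. c' y = c x)"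
proof -
  obtain M d where "Metric_space M d" and Xd: "X = Metric_space.mtopology M d"
    using X unfolding metrizable_space_def by blast
  interpret Metric_space M d by fact
  have "\<exists>r>0. x \<in> M \<and> (\<forall>y\<in>A. d x y < 2 * r \<longrightarrow> c y = c x)" if x: "x \<in> A" for x
  proof -
    obtain U where U: "openin X U" "x \<in> U" "\<forall>y\<in>U \<inter> A. c y = c x"
      using c x unfolding locally_constant_on_def by blast
    then obtain r where r: "r > 0" "mball x r \<subseteq> U" and "x \<in> M"
      unfolding Xd openin_mtopology by blast
    have "A \<subseteq> M"
      using c openin_subset unfolding locally_constant_on_def Xd by fastforce
    then have "c y = c x" if "y \<in> A" "d x y < r" for y
      using that r U(3) \<open>x \<in> M\<close> by (auto simp: subset_iff)
    then show ?thesis using r(1) \<open>x \<in> M\<close> by (intro exI[of _ "r / 2"]) auto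
  qed
  then obtain r where r: "\<And>x. x \<in> A \<Longrightarrow> r x > 0" "\<And>x. x \<in> A \<Longrightarrow> x \<in> M"
    "\<And>x y. x \<in> A \<Longrightarrow> y \<in> A \<Longrightarrow> d x y < 2 * r x \<Longrightarrow> c y = c x"
    by metis
  have same: "c x = c x'"
    if "x \<in> A" "x' \<in> A" "y \<in> mball x (r x)" "y \<in> mball x' (r x')" for x x' y
  proof -
    have "d x x' < r x + r x'"
      using that triangle[of x y x'] by (simp add: commute)
    then show ?thesis
      using r(3)[of x x'] r(3)[of x' x] that(1,2) commute[of x x'] by (cases "r x \<le> r x'") auto
  qed
  define c' where "c' y = c (SOME x. x \<in> A \<and> y \<in> mball x (r x))" for y
  have c': "c' y = c x" if "x \<in> A" "y \<in> mball x (r x)" for x y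
  proof -
    have "(SOME x. x \<in> A \<and> y \<in> mball x (r x)) \<in> A \<and>
          y \<in> mball (SOME x. x \<in> A \<and> y \<in> mball x (r x)) (r (SOME x. x \<in> A \<and> y \<in> mball x (r x)))"
      by (rule someI[where P = "\<lambda>x. x \<in> A \<and> y \<in> mball x (r x)"]) (use that in blast)
    then show ?thesis unfolding c'_def using that same by blast
  qed
  show ?thesis
  proof
    show "c' x = c x" if "x \<in> A" for x
      using c'[OF that, of x] r(1,2)[OF that] by simp
    show "\<exists>U. openin X U \<and> x \<in> U \<and> (\<forall>y\<in>U. c' y = c x)" if "x \<in> A" for x
      using c'[OF that] r(1,2)[OF that] unfolding Xd
      by (intro exI[of _ "mball x (r x)"]) (simp del: in_mball)
  qed
qed

lemma locally_constant_on_prefix: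
  fixes f :: "nat \<Rightarrow> 'a \<Rightarrow> 'b"
  assumes f: "\<And>m. locally_constant_on X A (f m)" and x: "x \<in> A"
  shows "\<exists>U. openin X U \<and> x \<in> U \<and> (\<forall>y\<in>U \<inter> A. \<forall>l\<le>k. f l y = f l x)"
proof -
  have "\<forall>l. \<exists>U. openin X U \<and> x \<in> U \<and> (\<forall>y\<in>U \<inter> A. f l y = f l x)"
    using f x unfolding locally_constant_on_def by blast
  then obtain U where U: "\<And>l. openin X (U l)" "\<And>l. x \<in> U l"
    "\<And>l y. y \<in> U l \<inter> A \<Longrightarrow> f l y = f l x"
    by metis
  have "openin X (\<Inter>l\<le>k. U l)" using U(1) by (intro openin_INT2) auto
  then show ?thesis using U(2,3) by (intro exI[of _ "\<Inter>l\<le>k. U l"]) auto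
qed

text \<open>Agreement up to stage \<open>m\<close> partitions \<open>A\<close> into relatively open classes, which get finer with \<open>m\<close>. Given an
open cover, every point takes its class at the first stage at which the class fits into a
member. Points of that class have the same first stage, so these classes are disjoint.\<close>

lemma zero_dim_inI_labels:
  fixes f :: "nat \<Rightarrow> 'a \<Rightarrow> 'b"
  assumes f: "\<And>m. locally_constant_on X A (f m)"
    and small: "\<And>x U. x \<in> A \<Longrightarrow> openin X U \<Longrightarrow> x \<in> U \<Longrightarrow>
                  \<exists>m. \<forall>y\<in>A. (\<forall>l\<le>m. f l y = f l x) \<longrightarrow> y \<in> U"
  shows "zero_dim_in X A"
  unfolding zero_dim_in_def
proof (intro allI impI)
  fix \<O> assume op: "\<forall>U\<in>\<O>. openin X U" and cov: "A \<subseteq> \<Union>\<O>"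
  define E where "E m x = {y \<in> A. \<forall>l\<le>m. f l y = f l x}" for m x
  define m where "m x = (LEAST m. \<exists>U\<in>\<O>. E m x \<subseteq> U)" for x
  define c where "c x = (SOME U. U \<in> \<O> \<and> E (m x) x \<subseteq> U)" for x
  have "\<exists>m. \<exists>U\<in>\<O>. E m x \<subseteq> U" if "x \<in> A" for x
  proof -
    obtain U where "U \<in> \<O>" "x \<in> U" using cov \<open>x \<in> A\<close> by blast
    moreover have "\<exists>m. E m x \<subseteq> U"
      using small[OF \<open>x \<in> A\<close>, of U] op calculation unfolding E_def by fast
    ultimately show ?thesis by blast
  qed
  then have m: "\<exists>U\<in>\<O>. E (m x) x \<subseteq> U" if "x \<in> A" for x
    unfolding m_def using LeastI_ex[of "\<lambda>m. \<exists>U\<in>\<O>. E m x \<subseteq> U"] that by blast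
  then have c: "c x \<in> \<O> \<and> E (m x) x \<subseteq> c x" if "x \<in> A" for x
    unfolding c_def using someI_ex[of "\<lambda>U. U \<in> \<O> \<and> E (m x) x \<subseteq> U"] that by blast
  have eq: "c y = c x" if "x \<in> A" "y \<in> E (m x) x" for x y
  proof -
    have E: "E k y = E k x" if "k \<le> m x" for k
      using \<open>y \<in> E (m x) x\<close> that unfolding E_def by auto
    have "m y = m x"
      unfolding m_def[of y]
    proof (rule Least_equality)
      show "\<exists>U\<in>\<O>. E (m x) y \<subseteq> U" using m[OF \<open>x \<in> A\<close>] E by simp
      show "m x \<le> k" if "\<exists>U\<in>\<O>. E k y \<subseteq> U" for k
        using that E[of k] Least_le[of "\<lambda>m. \<exists>U\<in>\<O>. E m x \<subseteq> U" k] unfolding m_def[of x]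
        by (metis nle_le)
    qed
    then show ?thesis unfolding c_def using E[of "m x"] by simp
  qed
  have nbhd: "\<exists>U. openin X U \<and> x \<in> U \<and> U \<inter> A \<subseteq> E k x" if "x \<in> A" for x k
  proof -
    obtain U where "openin X U" "x \<in> U" "\<forall>y\<in>U \<inter> A. \<forall>l\<le>k. f l y = f l x"
      using locally_constant_on_prefix[of X A f, OF f \<open>x \<in> A\<close>] by metis
    then show ?thesis unfolding E_def by blast
  qed
  show "\<exists>c. locally_constant_on X A c \<and> (\<forall>x\<in>A. x \<in> c x \<and> c x \<in> \<O>)"
  proof (intro exI conjI ballI)
    show "locally_constant_on X A c"
      unfolding locally_constant_on_def
    proof
      fix x assume x: "x \<in> A"
      obtain U where "openin X U" "x \<in> U" "U \<inter> A \<subseteq> E (m x) x" using nbhd[OF x] by blast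
      then show "\<exists>U. openin X U \<and> x \<in> U \<and> (\<forall>y\<in>U \<inter> A. c y = c x)" using eq[OF x] by blast
    qed
    fix x assume x: "x \<in> A"
    then show "x \<in> c x" "c x \<in> \<O>" using c[OF x] by (auto simp: E_def)
  qed
qed

text \<open>The metric is the ultrametric of the first stage at which two points have different labels.\<close>

lemma metrizable_space_labels:
  fixes f :: "nat \<Rightarrow> 'a \<Rightarrow> 'b"
  assumes t1: "t1_space X"
    and f: "\<And>m. locally_constant_on X (topspace X) (f m)"
    and small: "\<And>x U. openin X U \<Longrightarrow> x \<in> U \<Longrightarrow>
                  \<exists>m. \<forall>y\<in>topspace X. (\<forall>l\<le>m. f l y = f l x) \<longrightarrow> y \<in> U"
  shows "metrizable_space X"
proof -
  define D where "D x y = (if \<exists>m. f m x \<noteq> f m y then inverse (real (Suc (LEAST m. f m x \<noteq> f m y))) else 0)"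
    for x y
  have less: "D x y < inverse (real (Suc m)) \<longleftrightarrow> (\<forall>l\<le>m. f l x = f l y)" for x y m
  proof (cases "\<exists>m. f m x \<noteq> f m y")
    case True
    define k where "k = (LEAST m. f m x \<noteq> f m y)"
    have k: "f k x \<noteq> f k y" "\<And>l. l < k \<Longrightarrow> f l x = f l y"
      unfolding k_def using LeastI_ex[OF True] not_less_Least by blast+
    have "D x y = inverse (real (Suc k))" using True unfolding D_def k_def by simp
    then have "D x y < inverse (real (Suc m)) \<longleftrightarrow> m < k" by simp
    also have "\<dots> \<longleftrightarrow> (\<forall>l\<le>m. f l x = f l y)" using k by (meson le_less_trans not_le)
    finally show ?thesis .
  qed (auto simp: D_def)
  have val: "D x y = 0 \<or> (\<exists>m. D x y = inverse (real (Suc m)))" for x y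
    unfolding D_def by auto
  have comm: "D x y = D y x" for x y unfolding D_def by (simp add: eq_commute)
  have nonneg: "0 \<le> D x y" for x y unfolding D_def by simp
  interpret Metric_space "topspace X" D
  proof
    show "D x y = 0 \<longleftrightarrow> x = y" if xy: "x \<in> topspace X" "y \<in> topspace X" for x y
    proof
      assume D0: "D x y = 0"
      show "x = y"
      proof (rule ccontr)
        assume "x \<noteq> y"
        then obtain U where U: "openin X U" "x \<in> U" "y \<notin> U" using t1 xy unfolding t1_space_def by metis
        then obtain m where "(\<forall>l\<le>m. f l y = f l x) \<longrightarrow> y \<in> U" using small[OF U(1,2)] xy by blast
        moreover have "D y x < inverse (real (Suc m))" using D0 comm[of x y] by simp
        ultimately show False using less U(3) by blast
      qed
    qed (simp add: D_def)
    show "D x z \<le> D x y + D y z" for x y z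
    proof (rule ccontr)
      assume "\<not> D x z \<le> D x y + D y z"
      then have lt: "D x y < D x z" "D y z < D x z" using nonneg[of x y] nonneg[of y z] by linarith+
      then have "D x z \<noteq> 0" using nonneg[of x y] by linarith
      then obtain m where m: "D x z = inverse (real (Suc m))" using val by blast
      then have "\<forall>l\<le>m. f l x = f l z" using lt less[of x y m] less[of y z m] by simp
      then have "D x z < D x z" using less[of x z m] m by simp
      then show False by simp
    qed
  qed (use comm nonneg in auto)
  have "mtopology = X"
  proof (rule topology_eq[THEN iffD2], intro allI iffI)
    fix U assume U: "openin X U"
    show "openin mtopology U"
      unfolding openin_mtopology
    proof (intro conjI allI impI)
      show "U \<subseteq> topspace X" using U by (rule openin_subset)
      fix x assume "x \<in> U"
      then obtain m where m: "\<And>y. y \<in> topspace X \<Longrightarrow> (\<forall>l\<le>m. f l y = f l x) \<Longrightarrow> y \<in> U"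
        using small[OF U] by blast
      have "mball x (inverse (real (Suc m))) \<subseteq> U"
      proof
        fix y assume "y \<in> mball x (inverse (real (Suc m)))"
        then have "y \<in> topspace X" "\<forall>l\<le>m. f l x = f l y" using less by auto
        then show "y \<in> U" using m by metis
      qed
      then show "\<exists>r>0. mball x r \<subseteq> U" by (intro exI[of _ "inverse (real (Suc m))"]) simp
    qed
  next
    fix U assume U: "openin mtopology U"
    show "openin X U"
    proof (subst openin_subopen, clarify)
      fix x assume x: "x \<in> U"
      then obtain r where r: "r > 0" "mball x r \<subseteq> U" and xX: "x \<in> topspace X"
        using U unfolding openin_mtopology by blast
      obtain m where m: "inverse (real (Suc m)) < r" using reals_Archimedean[OF r(1)] by blast
      obtain V where V: "openin X V" "x \<in> V" "\<forall>y\<in>V \<inter> topspace X. \<forall>l\<le>m. f l y = f l x"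
        using locally_constant_on_prefix[of X "topspace X" f, OF f xX] by metis
      have "V \<subseteq> U"
      proof
        fix y assume y: "y \<in> V"
        then have yX: "y \<in> topspace X" using V(1) openin_subset by blast
        then have "D y x < inverse (real (Suc m))" unfolding less using y V(3) by blast
        then have "y \<in> mball x r" using m xX yX comm[of x y] by simp
        then show "y \<in> U" using r(2) by blast
      qed
      then show "\<exists>T. openin X T \<and> x \<in> T \<and> T \<subseteq> U" using V by blast
    qed
  qed
  then show ?thesis using metrizable_space_mtopology by simp
qed

lemma zero_dim_in_imp_covering_dim:
  assumes "zero_dim_in X (topspace X)" "topspace X \<noteq> {}"
  shows "covering_dim X = 0"
proof -
  have "\<exists>\<V>. finite_open_cover X \<V> \<and> (\<forall>V\<in>\<V>. \<exists>U\<in>\<U>. V \<subseteq> U) \<and>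
          (\<forall>\<W>\<subseteq>\<V>. card \<W> = nat 0 + 2 \<longrightarrow> \<Inter>\<W> = {})"
    if U: "finite_open_cover X \<U>" for \<U>
  proof -
    have "\<forall>U\<in>\<U>. openin X U" "topspace X \<subseteq> \<Union>\<U>" using U unfolding finite_open_cover_def by auto
    then obtain c where c: "locally_constant_on X (topspace X) c"
      "\<And>x. x \<in> topspace X \<Longrightarrow> x \<in> c x \<and> c x \<in> \<U>"
      using assms(1) unfolding zero_dim_in_def by meson
    define F where "F U = {x \<in> topspace X. c x = U}" for U
    have opF: "openin X (F U)" for U
    proof (subst openin_subopen, clarify)
      fix x assume "x \<in> F U"
      then have x: "x \<in> topspace X" "c x = U" unfolding F_def by auto
      then obtain V where V: "openin X V" "x \<in> V" "\<forall>y\<in>V \<inter> topspace X. c y = U"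
        using c(1) unfolding locally_constant_on_def by blast
      then have "V \<subseteq> F U" using openin_subset unfolding F_def by blast
      then show "\<exists>T. openin X T \<and> x \<in> T \<and> T \<subseteq> F U" using V by blast
    qed
    have "finite_open_cover X (F ` \<U>)"
      unfolding finite_open_cover_def
    proof (intro conjI)
      show "finite (F ` \<U>)" using U unfolding finite_open_cover_def by simp
      show "\<Union>(F ` \<U>) = topspace X" unfolding F_def using c(2) by auto
    qed (use opF in blast)
    moreover have "\<forall>V\<in>F ` \<U>. \<exists>U\<in>\<U>. V \<subseteq> U" unfolding F_def using c(2) by blast
    moreover have "\<Inter>\<W> = {}" if WF: "\<W> \<subseteq> F ` \<U>" and card: "card \<W> = nat 0 + 2" for \<W>
    proof -
      obtain A B where "\<W> = {A, B}" "A \<noteq> B" using card by (metis card_2_iff nat_0 add_0)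
      then show ?thesis using WF unfolding F_def by auto
    qed
    ultimately show ?thesis by blast
  qed
  then have "covering_dim_le X 0" unfolding covering_dim_le_def by auto
  moreover have "\<not> covering_dim_le X (0 - 1)" using assms(2) by (simp add: covering_dim_le_def)
  ultimately have "covering_dim X = ereal (of_int 0)" using covering_dim_eq_iff by blast
  then show ?thesis by (simp add: zero_ereal_def)
qed

lemma locally_constant_on_subtopology:
  assumes "A \<subseteq> K"
  shows "locally_constant_on (subtopology X K) A c \<longleftrightarrow> locally_constant_on X A c"
proof
  assume L: "locally_constant_on (subtopology X K) A c"
  show "locally_constant_on X A c"
    unfolding locally_constant_on_def
  proof
    fix x assume x: "x \<in> A"
    then obtain V where V: "openin (subtopology X K) V" "x \<in> V" "\<forall>y\<in>V \<inter> A. c y = c x"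
      using L unfolding locally_constant_on_def by blast
    then obtain U where U: "openin X U" "V = U \<inter> K" unfolding openin_subtopology by blast
    then have "U \<inter> A \<subseteq> V" using assms by blast
    then show "\<exists>U. openin X U \<and> x \<in> U \<and> (\<forall>y\<in>U \<inter> A. c y = c x)" using U V by blast
  qed
next
  assume L: "locally_constant_on X A c"
  show "locally_constant_on (subtopology X K) A c"
    unfolding locally_constant_on_def
  proof
    fix x assume x: "x \<in> A"
    then obtain U where U: "openin X U" "x \<in> U" "\<forall>y\<in>U \<inter> A. c y = c x"
      using L unfolding locally_constant_on_def by blast
    have "openin (subtopology X K) (U \<inter> K)" using U(1) by (auto simp: openin_subtopology)
    then show "\<exists>V. openin (subtopology X K) V \<and> x \<in> V \<and> (\<forall>y\<in>V \<inter> A. c y = c x)"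
      using U x assms by (intro exI[of _ "U \<inter> K"] conjI) blast+
  qed
qed

lemma zero_dim_in_subtopology:
  assumes "zero_dim_in (subtopology X K) K"
  shows "zero_dim_in X K"
  unfolding zero_dim_in_def
proof (intro allI impI)
  fix \<O> assume op: "\<forall>U\<in>\<O>. openin X U" and cov: "K \<subseteq> \<Union>\<O>"
  have "\<forall>W\<in>(\<lambda>U. U \<inter> K) ` \<O>. openin (subtopology X K) W"
    using op by (auto simp: openin_subtopology)
  moreover have "K \<subseteq> \<Union>((\<lambda>U. U \<inter> K) ` \<O>)" using cov by blast
  ultimately obtain c where c: "locally_constant_on (subtopology X K) K c"
    "\<And>x. x \<in> K \<Longrightarrow> x \<in> c x \<and> c x \<in> (\<lambda>U. U \<inter> K) ` \<O>"
    using assms unfolding zero_dim_in_def by meson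
  have "\<forall>W\<in>(\<lambda>U. U \<inter> K) ` \<O>. \<exists>U. U \<in> \<O> \<and> W = U \<inter> K" by blast
  then obtain u where u: "\<And>W. W \<in> (\<lambda>U. U \<inter> K) ` \<O> \<Longrightarrow> u W \<in> \<O> \<and> W = u W \<inter> K" by metis
  have "locally_constant_on X K c" using c(1) by (simp add: locally_constant_on_subtopology)
  then have "locally_constant_on X K (\<lambda>x. u (c x))" unfolding locally_constant_on_def by metis
  moreover have "x \<in> u (c x) \<and> u (c x) \<in> \<O>" if "x \<in> K" for x
    using c(2)[OF that] u[of "c x"] by blast
  ultimately show "\<exists>c. locally_constant_on X K c \<and> (\<forall>x\<in>K. x \<in> c x \<and> c x \<in> \<O>)" by blast
qed

text \<open>A partially built selection is final at \<open>x\<close> if it is correct there and constant on a neighbourhood in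
the whole space, not only relative to the subset treated so far. This makes it an open condition on \<open>x\<close>.\<close>

definition settled :: "'a topology \<Rightarrow> 'a set set \<Rightarrow> ('a \<Rightarrow> 'a set) \<Rightarrow> 'a \<Rightarrow> bool" where
  "settled X \<O> c x \<longleftrightarrow> x \<in> c x \<and> c x \<in> \<O> \<and> (\<exists>U. openin X U \<and> x \<in> U \<and> (\<forall>y\<in>U. c y = c x))"

lemma openin_settled:
  assumes "\<forall>U\<in>\<O>. openin X U"
  shows "openin X {x. settled X \<O> c x}"
proof (subst openin_subopen, clarify)
  fix x assume "settled X \<O> c x"
  then obtain U where U: "x \<in> c x" "c x \<in> \<O>" "openin X U" "x \<in> U" "\<forall>y\<in>U. c y = c x"
    unfolding settled_def by blast
  have "settled X \<O> c y" if "y \<in> U \<inter> c x" for y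
    using U that unfolding settled_def by (metis IntE)
  moreover have "openin X (U \<inter> c x)" "x \<in> U \<inter> c x" using U(1-4) assms by auto
  ultimately show "\<exists>T. openin X T \<and> x \<in> T \<and> T \<subseteq> {x. settled X \<O> c x}"
    by blast
qed

section \<open>The countable sum theorem\<close>

text \<open>The induction step of the countable sum theorem. A selection that is settled near the closure of \<open>H\<close> is
made to settle the points of a further zero-dimensional closed set \<open>A\<close> without a change on that closure. Since nothing
done so far is revised, the selections converge.\<close>

lemma settle_more:
  assumes X: "metrizable_space X" and \<O>: "\<forall>U\<in>\<O>. openin X U" "\<Union>\<O> = topspace X"
    and A: "closedin X A" "zero_dim_in X A"
    and H: "\<And>x. x \<in> X closure_of H \<Longrightarrow> settled X \<O> c x"
  obtains c' H' where "openin X H'" "A \<subseteq> H'" "X closure_of H \<subseteq> H'"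
    "\<And>x. x \<in> X closure_of H \<Longrightarrow> c' x = c x"
    "\<And>x. x \<in> X closure_of H' \<Longrightarrow> settled X \<O> c' x"
proof -
  define G where "G = {x. settled X \<O> c x}"
  have G: "openin X G" unfolding G_def by (rule openin_settled[OF \<O>(1)])
  have N: "normal_space X" using X by (rule metrizable_imp_normal_space)
  have "closedin X (X closure_of H)" by simp
  moreover have "X closure_of H \<subseteq> G" unfolding G_def using H by auto
  ultimately obtain P where P: "openin X P" "X closure_of H \<subseteq> P" "X closure_of P \<subseteq> G"
    using N G unfolding normal_space_alt by meson
  have PC: "P \<subseteq> X closure_of P"
    using P(1) by (simp add: closure_of_subset openin_subset)
  \<comment> \<open>A selection from \<open>\<Q>\<close> has to pick a fibre of \<open>c\<close> at every point of the closure of \<open>P\<close>,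
      hence agrees with \<open>c\<close> there; outside, it is free.\<close>
  define \<Q> where "\<Q> = {{x. c x = V} \<inter> G | V. V \<in> \<O>} \<union> {V - X closure_of P | V. V \<in> \<O>}"
  have "openin X ({x. c x = V} \<inter> G)" for V
  proof (subst openin_subopen, clarify)
    fix x assume "x \<in> G"
    then obtain U where U: "openin X U" "x \<in> U" "\<forall>y\<in>U. c y = c x"
      unfolding G_def settled_def by blast
    have "openin X (U \<inter> G)" using U(1) G by blast
    then show "\<exists>T. openin X T \<and> x \<in> T \<and> T \<subseteq> {y. c y = c x} \<inter> G"
      using U(2,3) \<open>x \<in> G\<close> by blast
  qed
  then have opQ: "\<forall>U\<in>\<Q>. openin X U" unfolding \<Q>_def using \<O> by auto
  have "A \<subseteq> \<Union>\<Q>"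
  proof
    fix x assume "x \<in> A"
    then have "x \<in> topspace X" using A closedin_subset by blast
    then obtain V where V: "V \<in> \<O>" "x \<in> V" using \<O> by auto
    show "x \<in> \<Union>\<Q>"
    proof (cases "x \<in> G")
      case True
      then have "c x \<in> \<O>" unfolding G_def settled_def by blast
      then have "{y. c y = c x} \<inter> G \<in> \<Q>" unfolding \<Q>_def by blast
      with True show ?thesis by blast
    next
      case False
      then have "x \<in> V - X closure_of P" using V P by blast
      moreover have "V - X closure_of P \<in> \<Q>" unfolding \<Q>_def using V by blast
      ultimately show ?thesis by blast
    qed
  qed
  then obtain q where q: "locally_constant_on X A q" "\<And>x. x \<in> A \<Longrightarrow> x \<in> q x \<and> q x \<in> \<Q>"
    using A(2) opQ unfolding zero_dim_in_def by meson
  have "\<exists>V. V \<in> \<O> \<and> (W = {x. c x = V} \<inter> G \<or> W = V - X closure_of P)" if "W \<in> \<Q>" for W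
    using that unfolding \<Q>_def by auto
  then obtain p where p: "\<And>W. W \<in> \<Q> \<Longrightarrow> p W \<in> \<O>"
    "\<And>W. W \<in> \<Q> \<Longrightarrow> W = {x. c x = p W} \<inter> G \<or> W = p W - X closure_of P"
    by metis
  define e where "e x = p (q x)" for x
  have e: "locally_constant_on X A e"
    using q(1) unfolding locally_constant_on_def e_def by metis
  have e_in: "e x \<in> \<O>" "x \<in> e x" "x \<in> X closure_of P \<Longrightarrow> e x = c x" if x: "x \<in> A" for x
  proof -
    have pq: "q x = {y. c y = e x} \<inter> G \<or> q x = e x - X closure_of P"
      using p(2)[of "q x"] q(2)[OF x] unfolding e_def by blast
    show "e x \<in> \<O>" unfolding e_def using p(1) q(2)[OF x] by blast
    show "x \<in> e x"
      using pq q(2)[OF x] unfolding G_def settled_def by auto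
    show "e x = c x" if "x \<in> X closure_of P"
      using pq q(2)[OF x] that by auto
  qed
  obtain e' where e': "\<And>x. x \<in> A \<Longrightarrow> e' x = e x"
    "\<And>x. x \<in> A \<Longrightarrow> \<exists>U. openin X U \<and> x \<in> U \<and> (\<forall>y\<in>U. e' y = e x)"
    using locally_constant_on_extend[OF X e] by blast
  \<comment> \<open>\<open>e'\<close> agrees with \<open>c\<close> near the points of \<open>A\<close> on the boundary of \<open>P\<close>, so that the two pieces fit
      together at every point of \<open>A\<close>; elsewhere on the boundary nothing is claimed.\<close>
  define c' where "c' x = (if x \<in> P then c x else e' x)" for x
  have c'H: "c' x = c x" if "x \<in> X closure_of H" for x
    using that P(2) unfolding c'_def by auto
  have settled_P: "settled X \<O> c' x" if "x \<in> P" for x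
  proof -
    have "x \<in> G" using that PC P(3) by blast
    then obtain U where U: "x \<in> c x" "c x \<in> \<O>" "openin X U" "x \<in> U" "\<forall>y\<in>U. c y = c x"
      unfolding G_def settled_def by blast
    have "openin X (U \<inter> P)" "x \<in> U \<inter> P" using U P(1) that by blast+
    moreover have "\<forall>y\<in>U \<inter> P. c' y = c' x" "c' x = c x" using U(5) that unfolding c'_def by (metis IntE)+
    ultimately show ?thesis unfolding settled_def using U(1,2) by metis
  qed
  have settled_A: "settled X \<O> c' x" if x: "x \<in> A" for x
  proof (cases "x \<in> P")
    case False
    have cx: "c' x = e x" using False e'(1)[OF x] unfolding c'_def by simp
    obtain U where U: "openin X U" "x \<in> U" "\<forall>y\<in>U. e' y = e x" using e'(2)[OF x] by blast
    have "\<exists>W. openin X W \<and> x \<in> W \<and> (\<forall>y\<in>W. c' y = e x)"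
    proof (cases "x \<in> X closure_of P")
      case True
      then have "x \<in> G" using P by blast
      then obtain W where W: "openin X W" "x \<in> W" "\<forall>y\<in>W. c y = c x"
        unfolding G_def settled_def by blast
      have "openin X (U \<inter> W)" "x \<in> U \<inter> W" using U W by blast+
      moreover have "\<forall>y\<in>U \<inter> W. c' y = e x"
        using U(3) W(3) e_in(3)[OF x True] unfolding c'_def by (metis IntE)
      ultimately show ?thesis by blast
    next
      case F: False
      have "c' y = e x" if "y \<in> U - X closure_of P" for y
        using that U(3) PC unfolding c'_def by (metis Diff_iff in_mono)
      moreover have "openin X (U - X closure_of P)" "x \<in> U - X closure_of P" using U(1,2) F by auto
      ultimately show ?thesis by blast
    qed
    then show ?thesis unfolding settled_def cx using e_in[OF x] by simp
  qed (rule settled_P)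
  define G' where "G' = {x. settled X \<O> c' x}"
  have "openin X G'" unfolding G'_def by (rule openin_settled[OF \<O>(1)])
  moreover have "X closure_of H \<union> A \<subseteq> G'"
    unfolding G'_def using settled_A settled_P P(2) by blast
  moreover have "closedin X (X closure_of H \<union> A)" using A(1) by (simp add: closedin_Un)
  ultimately obtain H' where "openin X H'" "X closure_of H \<union> A \<subseteq> H'" "X closure_of H' \<subseteq> G'"
    using N unfolding normal_space_alt by meson
  then show ?thesis
    using that[of H' c'] c'H unfolding G'_def by blast
qed

text \<open>Exhaust the space by open sets \<open>H k \<supseteq> A 0 \<union> \<dots> \<union> A (k - 1)\<close> such that each stage keeps the selection on the previous
set. The limit is locally constant because each \<open>H k\<close> is open and not only relatively open in the union
of the first few \<open>A i\<close>.\<close>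

lemma zero_dim_in_countable_sum:
  assumes X: "metrizable_space X"
    and A: "\<And>k. closedin X (A k)" "\<And>k::nat. zero_dim_in X (A k)"
    and cover: "(\<Union>k. A k) = topspace X"
  shows "zero_dim_in X (topspace X)"
  unfolding zero_dim_in_def
proof (intro allI impI)
  fix \<O> assume op: "\<forall>U\<in>\<O>. openin X U" and cov: "topspace X \<subseteq> \<Union>\<O>"
  have \<O>: "\<Union>\<O> = topspace X" using op cov openin_subset by blast
  let ?P = "\<lambda>cH :: ('a \<Rightarrow> 'a set) \<times> 'a set.
      openin X (snd cH) \<and> (\<forall>x \<in> X closure_of snd cH. settled X \<O> (fst cH) x)"
  let ?Q = "\<lambda>k (cH :: ('a \<Rightarrow> 'a set) \<times> 'a set) cH'. A k \<subseteq> snd cH' \<and> X closure_of snd cH \<subseteq> snd cH' \<and>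
      (\<forall>x \<in> X closure_of snd cH. fst cH' x = fst cH x)"
  have "\<exists>F. \<forall>k. ?P (F k) \<and> ?Q k (F k) (F (Suc k))"
  proof (rule dependent_nat_choice)
    show "\<exists>cH. ?P cH" by (rule exI[of _ "(\<lambda>_. {}, {})"]) simp
    fix cH k assume P: "?P cH"
    show "\<exists>cH'. ?P cH' \<and> ?Q k cH cH'"
      using settle_more[OF X op \<O> A[of k], of "snd cH" "fst cH"] P
      by (metis fst_conv snd_conv)
  qed
  then obtain F where F: "\<And>k. ?P (F k)" "\<And>k. ?Q k (F k) (F (Suc k))" by blast
  define H where "H k = snd (F k)" for k
  define c where "c k = fst (F k)" for k
  have opH: "openin X (H k)" for k using F(1) unfolding H_def by blast
  have clH: "H k \<subseteq> X closure_of (H k)" for k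
    using opH by (simp add: closure_of_subset openin_subset)
  have HS: "H k \<subseteq> H (Suc k)" for k using F(2)[of k] clH[of k] unfolding H_def by blast
  have mono: "H k \<subseteq> H l" if "k \<le> l" for k l
    using lift_Suc_mono_le[of H, OF HS that] .
  have c_eq: "c l x = c k x" if "k \<le> l" "x \<in> H k" for k l x
    using that(1)
  proof (induction l rule: dec_induct)
    case (step l)
    have "x \<in> X closure_of (H l)" using mono[OF step(1)] that(2) clH by blast
    then have "c (Suc l) x = c l x" using F(2)[of l] unfolding c_def H_def by blast
    with step show ?case by simp
  qed simp
  define c0 where "c0 x = c (LEAST k. x \<in> H k) x" for x
  have c0: "c0 x = c k x" if "x \<in> H k" for k x
  proof -
    have "x \<in> H (LEAST k. x \<in> H k)" "(LEAST k. x \<in> H k) \<le> k"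
      using that LeastI[of "\<lambda>k. x \<in> H k"] Least_le[of "\<lambda>k. x \<in> H k"] by auto
    then show ?thesis unfolding c0_def using c_eq by metis
  qed
  have inH: "\<exists>k. x \<in> H k" if "x \<in> topspace X" for x
  proof -
    obtain k where "x \<in> A k" using \<open>x \<in> topspace X\<close> cover by blast
    then show ?thesis using F(2)[of k] unfolding H_def by blast
  qed
  have st: "settled X \<O> c0 x" if "x \<in> topspace X" for x
  proof -
    obtain k where k: "x \<in> H k" using inH[OF \<open>x \<in> topspace X\<close>] by blast
    then have "settled X \<O> (c k) x" using F(1)[of k] clH unfolding c_def H_def by blast
    then obtain U where U: "x \<in> c k x" "c k x \<in> \<O>" "openin X U" "x \<in> U"
        "\<forall>y\<in>U. c k y = c k x"
      unfolding settled_def by blast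
    have "openin X (U \<inter> H k)" "x \<in> U \<inter> H k" using U k opH[of k] by blast+
    moreover have "\<forall>y\<in>U \<inter> H k. c0 y = c k x" using U(5) c0 by (metis IntE)
    ultimately show ?thesis unfolding settled_def c0[OF k] using U(1,2) by blast
  qed
  show "\<exists>c. locally_constant_on X (topspace X) c \<and> (\<forall>x\<in>topspace X. x \<in> c x \<and> c x \<in> \<O>)"
  proof (intro exI[of _ c0] conjI ballI)
    show "locally_constant_on X (topspace X) c0"
      unfolding locally_constant_on_def
    proof
      fix x assume "x \<in> topspace X"
      then obtain U where "openin X U" "x \<in> U" "\<forall>y\<in>U. c0 y = c0 x"
        using st[of x] unfolding settled_def by blast
      then show "\<exists>U. openin X U \<and> x \<in> U \<and> (\<forall>y\<in>U \<inter> topspace X. c0 y = c0 x)"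
        by blast
    qed
    fix x assume "x \<in> topspace X"
    then show "x \<in> c0 x" "c0 x \<in> \<O>" using st[of x] unfolding settled_def by blast+
  qed
qed

section \<open>Isolating the points outside a subset\<close>

text \<open>Tumarkin's enlargement: for every \<open>m\<close>, extend a selection on \<open>K\<close> with values of diameter at most
\<open>1 / (m + 1)\<close> to an open set \<open>G m\<close>, and let \<open>M\<close> be the intersection of the \<open>G m\<close>. A point outside
\<open>M\<close> is isolated in \<open>\<tau>(M)\<close> and drops out of some \<open>G m\<close>, where it can be its own label.\<close>

lemma zero_dim_in_enlarge:
  assumes X: "metrizable_space X" and K: "zero_dim_in X K" "K \<subseteq> topspace X"
  obtains M where "K \<subseteq> M" "M \<subseteq> topspace X" "metrizable_space (discretize_off X M)"
    "zero_dim_in (discretize_off X M) (topspace X)"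
proof -
  obtain M0 d where "Metric_space M0 d" and Xd: "X = Metric_space.mtopology M0 d"
    using X unfolding metrizable_space_def by blast
  interpret Metric_space M0 d by fact
  have top: "topspace X = M0" unfolding Xd by simp
  define \<O> where "\<O> m = {U. openin X U \<and> (\<forall>y\<in>U. \<forall>z\<in>U. d y z < inverse (real (Suc m)))}" for m
  have opO: "\<forall>U\<in>\<O> m. openin X U" for m unfolding \<O>_def by blast
  have "\<exists>c. K \<subseteq> {x. settled X (\<O> m) c x}" for m
  proof -
    have "K \<subseteq> \<Union>(\<O> m)"
    proof
      fix x assume "x \<in> K"
      then have x: "x \<in> M0" using K top by blast
      define r where "r = inverse (real (Suc m)) / 2"
      have "d y z < inverse (real (Suc m))" if "y \<in> mball x r" "z \<in> mball x r" for y z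
        using that triangle''[of y x z] unfolding r_def by auto
      then have "mball x r \<in> \<O> m" unfolding \<O>_def Xd by blast
      moreover have "x \<in> mball x r" using x unfolding r_def by simp
      ultimately show "x \<in> \<Union>(\<O> m)" by blast
    qed
    then obtain c where c: "locally_constant_on X K c" "\<And>x. x \<in> K \<Longrightarrow> x \<in> c x \<and> c x \<in> \<O> m"
      using K(1) opO unfolding zero_dim_in_def by meson
    obtain c' where c': "\<And>x. x \<in> K \<Longrightarrow> c' x = c x"
      "\<And>x. x \<in> K \<Longrightarrow> \<exists>U. openin X U \<and> x \<in> U \<and> (\<forall>y\<in>U. c' y = c x)"
      using locally_constant_on_extend[OF X c(1)] by blast
    have "settled X (\<O> m) c' x" if "x \<in> K" for x
      using c(2)[OF that] c'[OF that] unfolding settled_def by simp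
    then show ?thesis by blast
  qed
  then obtain c where c: "\<And>m. K \<subseteq> {x. settled X (\<O> m) (c m) x}" by metis
  define G where "G m = {x. settled X (\<O> m) (c m) x}" for m
  have G: "openin X (G m)" for m unfolding G_def by (rule openin_settled[OF opO])
  have Gc: "d y z < inverse (real (Suc m))" if "y \<in> G m" "z \<in> G m" "c m y = c m z" for m y z
    using that unfolding G_def settled_def \<O>_def by auto
  define M where "M = (\<Inter>m. G m)"
  have M: "K \<subseteq> M" "M \<subseteq> topspace X"
    unfolding M_def using c G[THEN openin_subset] unfolding G_def by blast+
  let ?Y = "discretize_off X M"
  have finer: "openin ?Y U" if "openin X U" for U
    using that unfolding openin_discretize_off by blast
  have single: "openin ?Y {x}" if "x \<in> topspace X - M" for x
    unfolding openin_discretize_off using that by (intro exI[of _ "{}"] exI[of _ "{x}"]) simp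
  \<comment> \<open>On \<open>G m\<close> the label is the selected small set, off \<open>G m\<close> it is the point itself.\<close>
  define f where "f m x = (if x \<in> G m then Inl (c m x) else Inr x)" for m x
  have f: "locally_constant_on ?Y (topspace X) (f m)" for m
    unfolding locally_constant_on_def
  proof
    fix x assume x: "x \<in> topspace X"
    show "\<exists>U. openin ?Y U \<and> x \<in> U \<and> (\<forall>y\<in>U \<inter> topspace X. f m y = f m x)"
    proof (cases "x \<in> G m")
      case True
      then obtain U where U: "openin X U" "x \<in> U" "\<forall>y\<in>U. c m y = c m x"
        unfolding G_def settled_def by blast
      have "openin ?Y (U \<inter> G m)" using U(1) G finer by blast
      moreover have "\<forall>y\<in>(U \<inter> G m) \<inter> topspace X. f m y = f m x"
        using U(3) True unfolding f_def by (metis IntE)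
      ultimately show ?thesis using U(2) True by blast
    next
      case False
      then have "openin ?Y {x}" using single x unfolding M_def by blast
      then show ?thesis by blast
    qed
  qed
  have fG: "d x y < inverse (real (Suc m))" if "f m y = f m x" "x \<in> G m" for m x y
    using that Gc[of x m y] unfolding f_def by (auto split: if_splits)
  have small: "\<exists>m. \<forall>y\<in>topspace X. (\<forall>l\<le>m. f l y = f l x) \<longrightarrow> y \<in> S"
    if S: "openin ?Y S" "x \<in> S" for x S
  proof (cases "x \<in> M")
    case True
    obtain U L where U: "openin X U" "L \<subseteq> topspace X - M" "S = U \<union> L"
      using S(1) unfolding openin_discretize_off by blast
    then have "x \<in> U" using S(2) True by blast
    then obtain r where r: "r > 0" "mball x r \<subseteq> U" "x \<in> M0"
      using U(1) unfolding Xd openin_mtopology by blast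
    obtain m where m: "inverse (real (Suc m)) < r" using reals_Archimedean[OF r(1)] by blast
    have "y \<in> S" if "y \<in> topspace X" "f m y = f m x" for y
    proof -
      have "x \<in> G m" using True unfolding M_def by blast
      then have "y \<in> mball x r" using fG[OF that(2)] m r(3) that(1) top by simp
      then show ?thesis using r(2) U(3) by blast
    qed
    then show ?thesis by blast
  next
    case False
    then obtain m where m: "x \<notin> G m" unfolding M_def by blast
    have "y = x" if "f m y = f m x" for y using that m unfolding f_def by (auto split: if_splits)
    then show ?thesis using S(2) by blast
  qed
  have t1: "t1_space ?Y"
  proof -
    have "t1_space X"
      using X metrizable_imp_Hausdorff_space Hausdorff_imp_t1_space by blast
    then show ?thesis using finer unfolding t1_space_def topspace_discretize_off by meson
  qed
  have "metrizable_space ?Y"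
    by (rule metrizable_space_labels[OF t1, of f]) (simp_all add: f small)
  moreover have "zero_dim_in ?Y (topspace X)"
    by (rule zero_dim_inI_labels[of _ _ f]) (use f small in auto)
  ultimately show thesis using that M by blast
qed

text \<open>At the points of \<open>M i\<close> the topologies \<open>\<tau>\<close> and \<open>\<tau>(M i)\<close> have the same neighbourhoods.\<close>

lemma Inter_discretize_off:
  assumes I: "I \<noteq> {}" and cov: "topspace X \<subseteq> (\<Union>i\<in>I. M i)"
  shows "Collect (openin X) = (\<Inter>i\<in>I. Collect (openin (discretize_off X (M i))))"
proof
  show "Collect (openin X) \<subseteq> (\<Inter>i\<in>I. Collect (openin (discretize_off X (M i))))"
    unfolding openin_discretize_off by blast
  show "(\<Inter>i\<in>I. Collect (openin (discretize_off X (M i)))) \<subseteq> Collect (openin X)"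
  proof
    fix S assume S: "S \<in> (\<Inter>i\<in>I. Collect (openin (discretize_off X (M i))))"
    have "openin X S"
    proof (subst openin_subopen, rule ballI)
      fix x assume x: "x \<in> S"
      have "S \<subseteq> topspace X" using S I openin_subset[of "discretize_off X (M _)" S] by auto
      then obtain i where i: "i \<in> I" "x \<in> M i" using x cov by blast
      then obtain U K where "openin X U" "K \<subseteq> topspace X - M i" "S = U \<union> K"
        using S unfolding openin_discretize_off by blast
      then show "\<exists>T. openin X T \<and> x \<in> T \<and> T \<subseteq> S" using x i(2) by blast
    qed
    then show "S \<in> Collect (openin X)" by simp
  qed
qed

section \<open>Paracompactness of metrizable spaces\<close>

text \<open>The choice takes the least member of the family that contains \<open>x\<close> in a well-order. If the choices for \<open>x\<close> and \<open>y\<close>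
differ, the smaller one misses the point that chose the larger one.\<close>

lemma minimal_member_choice:
  obtains f where "\<And>x. x \<in> \<Union>\<C> \<Longrightarrow> f x \<in> \<C> \<and> x \<in> f x"
    and "\<And>x y. x \<in> \<Union>\<C> \<Longrightarrow> y \<in> \<Union>\<C> \<Longrightarrow> f x \<noteq> f y \<Longrightarrow> x \<notin> f y \<or> y \<notin> f x"
proof -
  obtain r :: "'a set rel" where r: "Well_order r" "Field r = UNIV"
    using well_ordering[where 'a = "'a set"] by fast
  then have wf: "wf (r - Id)" and tot: "total r"
    unfolding well_order_on_def linear_order_on_def by auto
  have "\<exists>C. (C \<in> \<C> \<and> x \<in> C) \<and> (\<forall>D. (D, C) \<in> r - Id \<longrightarrow> \<not> (D \<in> \<C> \<and> x \<in> D))"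
    if "x \<in> \<Union>\<C>" for x
  proof -
    obtain B where "B \<in> {C. C \<in> \<C> \<and> x \<in> C}" using \<open>x \<in> \<Union>\<C>\<close> by blast
    from wf[unfolded wf_eq_minimal, rule_format, OF this]
    show ?thesis by (simp only: mem_Collect_eq Bex_def)
  qed
  then obtain f where f: "\<And>x. x \<in> \<Union>\<C> \<Longrightarrow> f x \<in> \<C> \<and> x \<in> f x"
    "\<And>x D. x \<in> \<Union>\<C> \<Longrightarrow> (D, f x) \<in> r - Id \<Longrightarrow> \<not> (D \<in> \<C> \<and> x \<in> D)"
    by metis
  show thesis
  proof (rule that[OF f(1)])
    fix x y assume xy: "x \<in> \<Union>\<C>" "y \<in> \<Union>\<C>" "f x \<noteq> f y"
    then have "(f x, f y) \<in> r - Id \<or> (f y, f x) \<in> r - Id"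
      using tot unfolding total_on_def by auto
    then show "x \<notin> f y \<or> y \<notin> f x" using f xy by blast
  qed
qed

text \<open>Stone's theorem that metrizable spaces are paracompact, after M. E. Rudin: at stage \<open>n\<close>, every point \<open>x\<close>
that was not covered before and has \<open>mball x (3 / 2^n)\<close> inside its chosen member contributes
\<open>mball x (1 / 2^n)\<close>, and the balls with the same chosen member are united.\<close>

lemma metrizable_locally_finite_refinement:
  assumes X: "metrizable_space X" and op: "\<And>C. C \<in> \<C> \<Longrightarrow> openin X C" and cov: "\<Union>\<C> = topspace X"
  obtains \<V> where "locally_finite_in X \<V>" "\<And>V. V \<in> \<V> \<Longrightarrow> openin X V" "\<Union>\<V> = topspace X"
    "\<And>V. V \<in> \<V> \<Longrightarrow> \<exists>C\<in>\<C>. V \<subseteq> C"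
proof -
  obtain M d where "Metric_space M d" and Xd: "X = Metric_space.mtopology M d"
    using X unfolding metrizable_space_def by blast
  interpret Metric_space M d by fact
  have M: "\<Union>\<C> = M" using cov unfolding Xd by simp
  obtain f where f: "\<And>x. x \<in> M \<Longrightarrow> f x \<in> \<C> \<and> x \<in> f x"
    "\<And>x y. x \<in> M \<Longrightarrow> y \<in> M \<Longrightarrow> f x \<noteq> f y \<Longrightarrow> x \<notin> f y \<or> y \<notin> f x"
    using minimal_member_choice[of \<C>] unfolding M by metis
  define ctr where "ctr n G C = {x \<in> M - G. f x = C \<and> mball x (3 / 2^n) \<subseteq> C}" for n :: nat and G C
  define G where "G = rec_nat {} (\<lambda>n G. G \<union> (\<Union>C. \<Union>x\<in>ctr n G C. mball x (1 / 2^n)))"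
  define D where "D n C = (\<Union>x\<in>ctr n (G n) C. mball x (1 / 2^n))" for n C
  have GS: "G (Suc n) = G n \<union> (\<Union>C. D n C)" for n unfolding G_def D_def by simp
  have G0: "G 0 = {}" unfolding G_def by simp
  have G_mono: "G m \<subseteq> G n" if "m \<le> n" for m n
    using lift_Suc_mono_le[of G, OF _ that] GS by blast
  have DG: "D m C \<subseteq> G n" if "m < n" for m n C
  proof -
    have "D m C \<subseteq> G (Suc m)" unfolding GS by blast
    then show ?thesis using G_mono[of "Suc m" n] that by simp
  qed
  have GD: "\<exists>m C. x \<in> D m C" if "x \<in> G n" for x n
    using that by (induction n) (auto simp: G0 GS)
  have opD: "openin X (D n C)" for n C
    unfolding D_def Xd by (rule openin_Union) blast
  have D_sub: "D n C \<subseteq> C" for n C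
  proof
    fix y assume "y \<in> D n C"
    then obtain x where x: "x \<in> ctr n (G n) C" "y \<in> mball x (1 / 2^n)" unfolding D_def by blast
    have "(1::real) / 2^n \<le> 3 / 2^n" by (simp add: divide_right_mono)
    then have "y \<in> mball x (3 / 2^n)" using mball_subset_concentric x(2) by blast
    then show "y \<in> C" using x(1) unfolding ctr_def by blast
  qed
  have covD: "\<exists>n C. x \<in> D n C" if x: "x \<in> M" for x
  proof -
    have "openin X (f x)" "x \<in> f x" using f(1)[OF x] op[of "f x"] by simp_all
    then obtain r where r: "r > 0" "mball x r \<subseteq> f x" unfolding Xd openin_mtopology by metis
    obtain n where n: "inverse (2::real) ^ n < r / 3"
      using real_arch_pow_inv[of "r / 3" "inverse 2"] r(1) by auto
    then have "3 / 2 ^ n \<le> r" by (simp add: field_simps)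
    then have sub: "mball x (3 / 2^n) \<subseteq> f x" using mball_subset_concentric r(2) by blast
    show ?thesis
    proof (cases "x \<in> G n")
      case False
      then have "x \<in> ctr n (G n) (f x)" using x sub unfolding ctr_def by blast
      then have "x \<in> D n (f x)" unfolding D_def using x by force
      then show ?thesis by blast
    qed (use GD in blast)
  qed
  have lf: "\<exists>N. openin X N \<and> x \<in> N \<and> finite {V \<in> {D n C | n C. C \<in> \<C>}. V \<inter> N \<noteq> {}}"
    if x: "x \<in> M" for x
  proof -
    obtain n C where nC: "x \<in> D n C" using covD[OF x] by blast
    then obtain r where r: "r > 0" "mball x r \<subseteq> D n C"
      using opD[of n C] unfolding Xd openin_mtopology by metis
    obtain j where j: "inverse (2::real) ^ j < r"
      using real_arch_pow_inv[of r "inverse 2"] r(1) by auto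
    define k where "k = n + j + 1"
    define B where "B = mball x (1 / 2 ^ k)"
    \<comment> \<open>Centres used after stage \<open>n\<close> lie outside \<open>D n C\<close>, hence at distance at least \<open>r\<close> from \<open>x\<close>.\<close>
    have far: "D i C' \<inter> B = {}" if "k \<le> i" for i C'
    proof (rule ccontr)
      assume "D i C' \<inter> B \<noteq> {}"
      then obtain p y where p: "p \<in> B" "p \<in> mball y (1 / 2^i)" "y \<in> ctr i (G i) C'"
        unfolding D_def by blast
      have "n < i" using that unfolding k_def by simp
      then have "y \<notin> D n C" using p(3) DG[of n i C] unfolding ctr_def by blast
      then have "y \<notin> mball x r" using r(2) by blast
      then have "r \<le> d x y" using p(2) x by auto
      moreover have "d x y < 1 / 2^k + 1 / 2^i"
        using p(1,2) triangle[of x p y] unfolding B_def by (auto simp: commute)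
      moreover have "(1::real) / 2^i \<le> 1 / 2^(Suc j)" "(1::real) / 2^k \<le> 1 / 2^(Suc j)"
        using that unfolding k_def
        by (intro divide_left_mono power_increasing; simp)+
      moreover have "(1::real) / 2^(Suc j) + 1 / 2^(Suc j) = inverse 2 ^ j"
        by (simp add: field_simps)
      ultimately show False using j by linarith
    qed
    \<comment> \<open>Centres of one stage \<open>i\<close> with different choices are at least \<open>3 / 2^i\<close> apart, so the
        sets that they generate are more than \<open>1 / 2^i\<close> apart.\<close>
    have one: "C1 = C2" if "D i C1 \<inter> B \<noteq> {}" "D i C2 \<inter> B \<noteq> {}" "i < k" for i C1 C2
    proof (rule ccontr)
      assume "C1 \<noteq> C2"
      obtain p y where p: "p \<in> B" "p \<in> mball y (1 / 2^i)" "y \<in> ctr i (G i) C1"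
        using \<open>D i C1 \<inter> B \<noteq> {}\<close> unfolding D_def by blast
      obtain q z where q: "q \<in> B" "q \<in> mball z (1 / 2^i)" "z \<in> ctr i (G i) C2"
        using \<open>D i C2 \<inter> B \<noteq> {}\<close> unfolding D_def by blast
      have yz: "y \<in> M" "z \<in> M" "f y = C1" "f z = C2" "mball y (3 / 2^i) \<subseteq> C1" "mball z (3 / 2^i) \<subseteq> C2"
        using p(3) q(3) unfolding ctr_def by auto
      have "y \<notin> C2 \<or> z \<notin> C1" using f(2)[of y z] yz \<open>C1 \<noteq> C2\<close> by blast
      then have "y \<notin> mball z (3 / 2^i) \<or> z \<notin> mball y (3 / 2^i)" using yz by blast
      then have "3 / 2^i \<le> d y z" using yz by (auto simp: commute)
      moreover have "d y z \<le> d y p + d p x + d x q + d q z"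
        using p(1,2) q(1,2) x yz(1,2) triangle[of y p z] triangle[of p x z] triangle[of x q z]
        unfolding B_def by auto
      moreover have "d y p < 1 / 2^i" "d p x < 1 / 2^k" "d x q < 1 / 2^k" "d q z < 1 / 2^i"
        using p(1,2) q(1,2) unfolding B_def by (auto simp: commute)
      moreover have "(1::real) / 2^k \<le> 1 / 2^(Suc i)"
        using \<open>i < k\<close> by (intro divide_left_mono power_increasing) auto
      moreover have "(1::real) / 2^(Suc i) + 1 / 2^(Suc i) = 1 / 2 ^ i" "(3::real) / 2^i = 3 * (1 / 2^i)"
        by (simp_all add: field_simps)
      ultimately show False by linarith
    qed
    have "{V \<in> {D n C | n C. C \<in> \<C>}. V \<inter> B \<noteq> {}} \<subseteq> (\<Union>i<k. {V \<in> range (D i). V \<inter> B \<noteq> {}})"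
    proof
      fix V assume "V \<in> {V \<in> {D n C | n C. C \<in> \<C>}. V \<inter> B \<noteq> {}}"
      then obtain i C' where V: "V = D i C'" "D i C' \<inter> B \<noteq> {}" by blast
      then have "i < k" using far[of i C'] by (cases "i < k") auto
      with V show "V \<in> (\<Union>i<k. {V \<in> range (D i). V \<inter> B \<noteq> {}})" by blast
    qed
    moreover have "finite (\<Union>i<k. {V \<in> range (D i). V \<inter> B \<noteq> {}})"
    proof (rule finite_UN_I[OF finite_lessThan])
      fix i assume "i \<in> {..<k}"
      then have sing: "\<And>V W. V \<in> {V \<in> range (D i). V \<inter> B \<noteq> {}} \<Longrightarrow>
          W \<in> {V \<in> range (D i). V \<inter> B \<noteq> {}} \<Longrightarrow> V = W"
        using one[of i] by auto
      show "finite {V \<in> range (D i). V \<inter> B \<noteq> {}}"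
      proof (cases "{V \<in> range (D i). V \<inter> B \<noteq> {}} = {}")
        case False
        then obtain W where W: "W \<in> {V \<in> range (D i). V \<inter> B \<noteq> {}}" by blast
        have "{V \<in> range (D i). V \<inter> B \<noteq> {}} \<subseteq> {W}"
          by (rule subsetI) (simp only: sing[OF _ W] singleton_iff)
        then show ?thesis by (rule finite_subset) simp
      qed (simp only: finite.emptyI)
    qed
    ultimately have "finite {V \<in> {D n C | n C. C \<in> \<C>}. V \<inter> B \<noteq> {}}"
      by (rule finite_subset)
    moreover have "openin X B" "x \<in> B" unfolding B_def Xd using x by auto
    ultimately show ?thesis by blast
  qed
  show thesis
  proof
    have sub: "D n C \<subseteq> M" for n C using opD[of n C] openin_subset unfolding Xd by fastforce
    show "locally_finite_in X {D n C | n C. C \<in> \<C>}"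
      unfolding locally_finite_in_def using lf sub unfolding Xd by auto
    show "openin X V" if "V \<in> {D n C | n C. C \<in> \<C>}" for V using that opD by auto
    have inC: "C \<in> \<C>" if "x \<in> D n C" for x n C
      using that f(1) unfolding D_def ctr_def by auto
    show "\<Union>{D n C | n C. C \<in> \<C>} = topspace X"
    proof
      show "\<Union>{D n C | n C. C \<in> \<C>} \<subseteq> topspace X" unfolding Xd topspace_mtopology using sub by blast
      show "topspace X \<subseteq> \<Union>{D n C | n C. C \<in> \<C>}"
      proof
        fix x assume "x \<in> topspace X"
        then obtain n C where "x \<in> D n C" using covD[of x] unfolding Xd topspace_mtopology by blast
        then show "x \<in> \<Union>{D n C | n C. C \<in> \<C>}" using inC[of x n C] by blast
      qed
    qed
    show "\<exists>C\<in>\<C>. V \<subseteq> C" if "V \<in> {D n C | n C. C \<in> \<C>}" for V using that D_sub by blast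
  qed
qed

section \<open>From finite to locally finite covers\<close>

text \<open>A refinement of order at most \<open>n + 1\<close> of the finite cover that consists of \<open>V U\<close> for \<open>U \<in> T\<close> and the union of all
other \<open>V U\<close>. As each set of the refinement is assigned to one \<open>U\<close> only, a common point of the new \<open>V' U\<close> for \<open>U \<in> T\<close> would lie in
\<open>n + 2\<close> distinct sets of the refinement.\<close>

lemma reduce_one_intersection:
  assumes dim: "covering_dim_le X (int n)"
    and V: "\<And>U. U \<in> \<U> \<Longrightarrow> openin X (V U)" "(\<Union>U\<in>\<U>. V U) = topspace X"
    and T: "T \<subseteq> \<U>" "card T = n + 2"
  obtains V' where "\<And>U. U \<in> T \<Longrightarrow> openin X (V' U) \<and> V' U \<subseteq> V U"
    "topspace X \<subseteq> (\<Union>U\<in>T. V' U) \<union> (\<Union>U\<in>\<U> - T. V U)" "(\<Inter>U\<in>T. V' U) = {}"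
proof -
  have finT: "finite T" and neT: "T \<noteq> {}" using T(2) by (auto intro: card_ge_0_finite)
  define W where "W = (\<Union>U\<in>\<U> - T. V U)"
  have "openin X W" unfolding W_def by (rule openin_Union) (use V(1) in auto)
  moreover have "\<Union>(insert W (V ` T)) = topspace X"
  proof -
    have "\<U> = (\<U> - T) \<union> T" using T(1) by (simp add: Un_absorb2)
    then have "(\<Union>U\<in>\<U>. V U) = W \<union> (\<Union>U\<in>T. V U)" unfolding W_def by (metis UN_Un)
    then show ?thesis using V(2) by simp
  qed
  ultimately have "finite_open_cover X (insert W (V ` T))"
    unfolding finite_open_cover_def using finT V(1) T(1) by auto
  then obtain \<E> where \<E>: "finite_open_cover X \<E>" "\<And>E. E \<in> \<E> \<Longrightarrow> \<exists>A\<in>insert W (V ` T). E \<subseteq> A"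
    "\<And>\<W>. \<W> \<subseteq> \<E> \<Longrightarrow> card \<W> = n + 2 \<Longrightarrow> \<Inter>\<W> = {}"
    using dim unfolding covering_dim_le_def by auto
  define g where "g E = (SOME U. U \<in> T \<and> E \<subseteq> V U)" for E
  have g: "g E \<in> T \<and> E \<subseteq> V (g E)" if "U \<in> T" "E \<subseteq> V U" for E U
    unfolding g_def by (rule someI[where P = "\<lambda>U. U \<in> T \<and> E \<subseteq> V U"]) (use that in blast)
  define V' where "V' U = \<Union>{E \<in> \<E>. g E = U \<and> E \<subseteq> V U}" for U
  show thesis
  proof
    show "openin X (V' U) \<and> V' U \<subseteq> V U" for U
      using \<E>(1) unfolding V'_def finite_open_cover_def by (auto intro!: openin_Union)
    show "topspace X \<subseteq> (\<Union>U\<in>T. V' U) \<union> (\<Union>U\<in>\<U> - T. V U)"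
    proof
      fix x assume "x \<in> topspace X"
      then obtain E where E: "E \<in> \<E>" "x \<in> E" using \<E>(1) unfolding finite_open_cover_def by blast
      show "x \<in> (\<Union>U\<in>T. V' U) \<union> (\<Union>U\<in>\<U> - T. V U)"
      proof (cases "E \<subseteq> W")
        case False
        then obtain U where "U \<in> T" "E \<subseteq> V U" using \<E>(2)[OF E(1)] by blast
        then have "g E \<in> T" "E \<subseteq> V (g E)" using g by blast+
        then show ?thesis using E unfolding V'_def by blast
      qed (use E W_def in blast)
    qed
    show "(\<Inter>U\<in>T. V' U) = {}"
    proof (rule ccontr)
      assume "(\<Inter>U\<in>T. V' U) \<noteq> {}"
      then obtain x where x: "\<forall>U\<in>T. x \<in> V' U" by blast
      then have "\<forall>U\<in>T. \<exists>E. E \<in> \<E> \<and> g E = U \<and> x \<in> E" unfolding V'_def by blast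
      then obtain e where e: "\<And>U. U \<in> T \<Longrightarrow> e U \<in> \<E> \<and> g (e U) = U \<and> x \<in> e U" by metis
      have "inj_on e T" by (rule inj_on_inverseI[of _ g]) (use e in blast)
      then have "card (e ` T) = n + 2" using T(2) by (simp add: card_image)
      moreover have "e ` T \<subseteq> \<E>" using e by blast
      ultimately have "\<Inter>(e ` T) = {}" using \<E>(3) by blast
      moreover have "x \<in> \<Inter>(e ` T)" using e by blast
      ultimately show False by blast
    qed
  qed
qed

text \<open>Dowker's theorem. The intersections over the \<open>(n + 2)\<close>-element subfamilies \<open>T\<close> are emptied one after the other,
transfinitely often. The step for \<open>T\<close> changes sets only inside \<open>C T\<close>, the closure of \<open>\<Inter>T\<close>. Because the original
family is locally finite, near a given point only finitely many \<open>C T\<close> occur. Hence the process is locally stationary and limits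
of shrinkings are open covers again. Zorn's lemma is applied to pairs of the set of subfamilies that are done and the current
shrinking; the order records that changes are confined to the \<open>C T\<close> done in between.\<close>

lemma locally_finite_shrinking:
  assumes dim: "covering_dim_le X (int n)"
    and lf: "locally_finite_in X \<U>" and op: "\<And>U. U \<in> \<U> \<Longrightarrow> openin X U"
    and cov: "\<Union>\<U> = topspace X"
  obtains V where "\<And>U. U \<in> \<U> \<Longrightarrow> openin X (V U)" "\<And>U. V U \<subseteq> U" "(\<Union>U\<in>\<U>. V U) = topspace X"
    "\<And>T. T \<subseteq> \<U> \<Longrightarrow> card T = n + 2 \<Longrightarrow> (\<Inter>U\<in>T. V U) = {}"
proof -
  define TT where "TT = {T. T \<subseteq> \<U> \<and> card T = n + 2}"
  define C where "C T = X closure_of \<Inter>T" for T :: "'a set set"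
  define A where "A = {DV :: 'a set set set \<times> ('a set \<Rightarrow> 'a set).
      fst DV \<subseteq> TT \<and> (\<forall>U. snd DV U \<subseteq> U) \<and> (\<forall>U\<in>\<U>. openin X (snd DV U)) \<and>
      (\<Union>U\<in>\<U>. snd DV U) = topspace X \<and> (\<forall>T\<in>fst DV. (\<Inter>U\<in>T. snd DV U) = {})}"
  define P where "P a b \<longleftrightarrow> fst a \<subseteq> fst b \<and>
      (\<forall>U. snd b U \<subseteq> snd a U \<and> snd a U \<subseteq> snd b U \<union> (\<Union>T\<in>fst b - fst a. C T))"
    for a b :: "'a set set set \<times> ('a set \<Rightarrow> 'a set)"
  have PD: "fst a \<subseteq> fst b" and PV: "snd b U \<subseteq> snd a U"
    and PC: "x \<in> snd a U \<Longrightarrow> x \<notin> snd b U \<Longrightarrow> \<exists>T\<in>fst b - fst a. x \<in> C T"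
    if "P a b" for a b U x
    using that unfolding P_def by (blast, blast, blast)
  have AI: "DV \<in> A" if "fst DV \<subseteq> TT" "\<And>U. snd DV U \<subseteq> U" "\<And>U. U \<in> \<U> \<Longrightarrow> openin X (snd DV U)"
    "topspace X \<subseteq> (\<Union>U\<in>\<U>. snd DV U)" "\<And>T. T \<in> fst DV \<Longrightarrow> (\<Inter>U\<in>T. snd DV U) = {}" for DV
  proof -
    have "(\<Union>U\<in>\<U>. snd DV U) = topspace X" using that(2,4) cov by blast
    then show ?thesis using that(1,2,3,5) by (simp add: A_def)
  qed
  have Asub: "fst a \<subseteq> TT" "snd a U \<subseteq> U" "(\<Union>U\<in>\<U>. snd a U) = topspace X"
    and Aop: "U \<in> \<U> \<Longrightarrow> openin X (snd a U)"
    and Aint: "T \<in> fst a \<Longrightarrow> (\<Inter>U\<in>T. snd a U) = {}"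
    if "a \<in> A" for a U T
    using that unfolding A_def by simp_all
  have po: "partial_order_on A (relation_of P A)"
  proof (rule partial_order_on_relation_ofI)
    show "P a a" for a unfolding P_def by blast
    show "P a c" if "P a b" "P b c" for a b c
      unfolding P_def
    proof (intro conjI allI subsetI)
      show "x \<in> fst c" if "x \<in> fst a" for x
        using that PD[OF \<open>P a b\<close>] PD[OF \<open>P b c\<close>] by blast
      show "x \<in> snd a U" if "x \<in> snd c U" for x U
        using that PV[OF \<open>P a b\<close>] PV[OF \<open>P b c\<close>] by blast
      show "x \<in> snd c U \<union> (\<Union>T\<in>fst c - fst a. C T)" if "x \<in> snd a U" for x U
        using that PC[OF \<open>P a b\<close>, of x U] PC[OF \<open>P b c\<close>, of x U] PD[OF \<open>P a b\<close>] PD[OF \<open>P b c\<close>]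
        by blast
    qed
    show "a = b" if "P a b" "P b a" for a b
    proof (rule prod_eqI)
      show "fst a = fst b" using PD that by blast
      show "snd a = snd b"
        using PV[OF that(1)] PV[OF that(2)] by (intro ext) (rule subset_antisym)
    qed
  qed
  have id: "({}, \<lambda>U. U) \<in> A" by (rule AI) (use op cov in auto)
  have ub: "\<exists>u\<in>A. \<forall>a\<in>Ch. P a u" if Ch: "Ch \<in> Chains (relation_of P A)" for Ch
  proof (cases "Ch = {}")
    case False
    have ChA: "a \<in> A" if "a \<in> Ch" for a
      using Ch that unfolding Chains_def relation_of_def by blast
    have tot: "P a b \<or> P b a" if "a \<in> Ch" "b \<in> Ch" for a b
      using Ch that unfolding Chains_def relation_of_def by blast
    define u where "u = (\<Union>a\<in>Ch. fst a, \<lambda>U. \<Inter>a\<in>Ch. snd a U)"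
    have u: "fst u = (\<Union>a\<in>Ch. fst a)" "snd u U = (\<Inter>a\<in>Ch. snd a U)" for U
      unfolding u_def by auto
    \<comment> \<open>An element \<open>a\<close> of the chain that has dealt with as many of the subfamilies
        relevant near \<open>x\<close> as any other is final near \<open>x\<close>.\<close>
    have stable: "\<exists>N a. openin X N \<and> x \<in> N \<and> a \<in> Ch \<and> (\<forall>U. snd a U \<inter> N \<subseteq> snd u U)"
      if x: "x \<in> topspace X" for x
    proof -
      obtain N where N: "openin X N" "x \<in> N" "finite {U\<in>\<U>. U \<inter> N \<noteq> {}}"
        using lf x unfolding locally_finite_in_def by blast
      define R where "R = Pow {U\<in>\<U>. U \<inter> N \<noteq> {}}"
      have finR: "finite R" unfolding R_def using N(3) by simp
      obtain a0 where "a0 \<in> Ch" using False by blast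
      moreover have "\<forall>a. a \<in> Ch \<longrightarrow> card (fst a \<inter> R) < Suc (card R)"
        using finR by (auto simp: less_Suc_eq_le intro: card_mono)
      ultimately have "\<exists>a. a \<in> Ch \<and> (\<forall>b. b \<in> Ch \<longrightarrow> card (fst b \<inter> R) \<le> card (fst a \<inter> R))"
        by (rule ex_has_greatest_nat)
      then obtain a where a: "a \<in> Ch" "\<And>b. b \<in> Ch \<Longrightarrow> card (fst b \<inter> R) \<le> card (fst a \<inter> R)"
        by blast
      have "snd a U \<inter> N \<subseteq> snd b U" if b: "b \<in> Ch" for b U
        using tot[OF a(1) b]
      proof
        assume "P b a"
        then show ?thesis using PV by blast
      next
        assume ab: "P a b"
        have "fst a \<inter> R = fst b \<inter> R"
          using PD[OF ab] a(2)[OF b] finR by (intro card_seteq) auto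
        show ?thesis
        proof (rule ccontr)
          assume "\<not> snd a U \<inter> N \<subseteq> snd b U"
          then obtain y where y: "y \<in> snd a U" "y \<in> N" "y \<notin> snd b U" by blast
          then obtain T where T: "T \<in> fst b - fst a" "y \<in> C T" using PC[OF ab] by blast
          have "T \<notin> R" using T \<open>fst a \<inter> R = fst b \<inter> R\<close> by blast
          moreover have "T \<subseteq> \<U>" using T Asub(1)[OF ChA[OF b]] unfolding TT_def by blast
          ultimately obtain U' where "U' \<in> T" "U' \<inter> N = {}" unfolding R_def by blast
          then have "N \<inter> \<Inter>T = {}" by blast
          then have "N \<inter> C T = {}" unfolding C_def using N(1) by (simp add: openin_Int_closure_of_eq_empty)
          then show False using y(2) T(2) by blast
        qed
      qed
      then have "\<forall>U. snd a U \<inter> N \<subseteq> snd u U" unfolding u by blast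
      then show ?thesis using N(1,2) a(1) by blast
    qed
    have sub: "snd u U \<subseteq> snd a U" if "a \<in> Ch" for a U using that unfolding u by blast
    have "u \<in> A"
    proof (rule AI)
      show "fst u \<subseteq> TT" unfolding u using Asub(1) ChA by blast
      show "snd u U \<subseteq> U" for U
        using False sub Asub(2) ChA by blast
      show "openin X (snd u U)" if U: "U \<in> \<U>" for U
      proof (subst openin_subopen, clarify)
        fix x assume x: "x \<in> snd u U"
        obtain b where "b \<in> Ch" using False by blast
        then have "openin X (snd b U)" "x \<in> snd b U" using x sub Aop[OF ChA U] by blast+
        then have "x \<in> topspace X" using openin_subset by blast
        then obtain N a where N: "openin X N" "x \<in> N" "a \<in> Ch" "\<forall>U. snd a U \<inter> N \<subseteq> snd u U"
          using stable by metis
        have "openin X (snd a U \<inter> N)" using N(1) Aop[OF ChA[OF N(3)] U] by blast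
        then show "\<exists>S. openin X S \<and> x \<in> S \<and> S \<subseteq> snd u U"
          using N x sub[OF N(3)] by blast
      qed
      show "topspace X \<subseteq> (\<Union>U\<in>\<U>. snd u U)"
      proof
        fix x assume "x \<in> topspace X"
        then obtain N a where N: "openin X N" "x \<in> N" "a \<in> Ch" "\<forall>U. snd a U \<inter> N \<subseteq> snd u U"
          using stable by metis
        obtain U where "U \<in> \<U>" "x \<in> snd a U"
          using \<open>x \<in> topspace X\<close> Asub(3)[OF ChA[OF N(3)]] by blast
        then show "x \<in> (\<Union>U\<in>\<U>. snd u U)" using N by blast
      qed
      show "(\<Inter>U\<in>T. snd u U) = {}" if "T \<in> fst u" for T
      proof -
        obtain a where a: "a \<in> Ch" "T \<in> fst a" using \<open>T \<in> fst u\<close> unfolding u by blast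
        then have "(\<Inter>U\<in>T. snd a U) = {}" using Aint ChA by blast
        then show ?thesis using sub[OF a(1)] by blast
      qed
    qed
    moreover have "P a u" if a: "a \<in> Ch" for a
      unfolding P_def
    proof (intro conjI allI)
      show "fst a \<subseteq> fst u" unfolding u using a by blast
      show "snd u U \<subseteq> snd a U" for U using sub[OF a] .
      show "snd a U \<subseteq> snd u U \<union> (\<Union>T\<in>fst u - fst a. C T)" for U
      proof
        fix x assume x: "x \<in> snd a U"
        show "x \<in> snd u U \<union> (\<Union>T\<in>fst u - fst a. C T)"
        proof (cases "x \<in> snd u U")
          case False
          then obtain b where b: "b \<in> Ch" "x \<notin> snd b U" unfolding u by blast
          then have "P a b" using tot[OF a b(1)] PV x by blast
          then obtain T where "T \<in> fst b - fst a" "x \<in> C T" using PC x b(2) by blast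
          then show ?thesis using b(1) unfolding u by blast
        qed blast
      qed
    qed
    ultimately show ?thesis by blast
  qed (use id in blast)
  obtain m where m: "m \<in> A" "\<And>a. a \<in> A \<Longrightarrow> P m a \<Longrightarrow> a = m"
    using predicate_Zorn[OF po ub] by blast
  have "T \<in> fst m" if T: "T \<subseteq> \<U>" "card T = n + 2" for T
  proof (rule ccontr)
    assume "T \<notin> fst m"
    obtain V' where V': "\<And>U. U \<in> T \<Longrightarrow> openin X (V' U) \<and> V' U \<subseteq> snd m U"
      "topspace X \<subseteq> (\<Union>U\<in>T. V' U) \<union> (\<Union>U\<in>\<U> - T. snd m U)" "(\<Inter>U\<in>T. V' U) = {}"
      using reduce_one_intersection[of X n \<U> "snd m" T, OF dim Aop[OF m(1)] Asub(3)[OF m(1)] T] by blast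
    \<comment> \<open>Outside \<open>C T\<close> the old sets are kept. As \<open>C T\<close> contains \<open>\<Inter>T\<close>, the points kept there
        do not contribute to the intersection over \<open>T\<close>.\<close>
    define V where "V U = (if U \<in> T then V' U \<union> (snd m U - C T) else snd m U)" for U
    have Vm: "V U \<subseteq> snd m U" for U using V'(1) unfolding V_def by auto
    have "(insert T (fst m), V) \<in> A"
    proof (rule AI; unfold fst_conv snd_conv)
      show "insert T (fst m) \<subseteq> TT" using T Asub(1)[OF m(1)] unfolding TT_def by blast
      show "V U \<subseteq> U" for U using Vm Asub(2)[OF m(1)] by blast
      show "openin X (V U)" if "U \<in> \<U>" for U
        using V'(1) Aop[OF m(1) that] unfolding V_def C_def by (auto intro!: openin_Un openin_diff)
      show "topspace X \<subseteq> (\<Union>U\<in>\<U>. V U)"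
      proof
        fix x assume "x \<in> topspace X"
        then consider U where "U \<in> T" "x \<in> V' U" | U where "U \<in> \<U> - T" "x \<in> snd m U" using V'(2) by blast
        then have "\<exists>U\<in>\<U>. x \<in> V U"
        proof cases
          case 1
          then have "x \<in> V U" unfolding V_def by simp
          then show ?thesis using 1 T by blast
        next
          case 2
          then have "x \<in> V U" unfolding V_def by simp
          then show ?thesis using 2 by blast
        qed
        then show "x \<in> (\<Union>U\<in>\<U>. V U)" by blast
      qed
      show "(\<Inter>U\<in>T'. V U) = {}" if "T' \<in> insert T (fst m)" for T'
      proof (cases "T' \<in> fst m")
        case True
        then show ?thesis using Aint[OF m(1)] Vm by blast
      next
        case False
        then have "T' = T" using that by blast
        have V'x: "x \<in> V' U" if "\<forall>U\<in>T. x \<in> V U" "U \<in> T" for x U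
        proof -
          have "\<forall>U\<in>T. x \<in> U" using that(1) Vm Asub(2)[OF m(1)] by blast
          then have "x \<in> \<Inter>T" by blast
          moreover have "x \<in> topspace X"
            using that Vm Asub(3)[OF m(1)] T(1) by blast
          ultimately have "x \<in> C T" unfolding C_def by (meson closure_of_subset_Int IntI subsetD)
          then show ?thesis using that unfolding V_def by (metis DiffD2 UnE)
        qed
        show ?thesis
        proof (rule ccontr)
          assume "(\<Inter>U\<in>T'. V U) \<noteq> {}"
          then obtain x where "\<forall>U\<in>T. x \<in> V U" unfolding \<open>T' = T\<close> by blast
          then have "x \<in> (\<Inter>U\<in>T. V' U)" using V'x by simp
          then show False using V'(3) by simp
        qed
      qed
    qed
    moreover have "P m (insert T (fst m), V)"
      using Vm \<open>T \<notin> fst m\<close> unfolding P_def V_def by auto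
    ultimately have "(insert T (fst m), V) = m" using m(2) by simp
    then have "T \<in> fst m" by (metis fst_conv insertI1)
    then show False using \<open>T \<notin> fst m\<close> by simp
  qed
  then have "(\<Inter>U\<in>T. snd m U) = {}" if "T \<subseteq> \<U>" "card T = n + 2" for T
    using Aint[OF m(1)] that by simp
  then show thesis
    using that[of "snd m"] Aop[OF m(1)] Asub(2,3)[OF m(1)] by simp
qed

lemma metrizable_dim_refinement:
  assumes X: "metrizable_space X" and dim: "covering_dim_le X (int n)"
    and \<C>: "\<And>C. C \<in> \<C> \<Longrightarrow> openin X C" "\<Union>\<C> = topspace X"
  obtains \<V> where "locally_finite_in X \<V>" "\<And>V. V \<in> \<V> \<Longrightarrow> openin X V" "\<Union>\<V> = topspace X"
    "\<And>V. V \<in> \<V> \<Longrightarrow> \<exists>C\<in>\<C>. V \<subseteq> C" "\<And>x. finite {V\<in>\<V>. x \<in> V} \<and> card {V\<in>\<V>. x \<in> V} \<le> n + 1"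
proof -
  obtain \<U> where \<U>: "locally_finite_in X \<U>" "\<And>V. V \<in> \<U> \<Longrightarrow> openin X V" "\<Union>\<U> = topspace X"
    "\<And>V. V \<in> \<U> \<Longrightarrow> \<exists>C\<in>\<C>. V \<subseteq> C"
    using metrizable_locally_finite_refinement[OF X \<C>] by metis
  obtain V where V: "\<And>U. U \<in> \<U> \<Longrightarrow> openin X (V U)" "\<And>U. V U \<subseteq> U" "(\<Union>U\<in>\<U>. V U) = topspace X"
    "\<And>T. T \<subseteq> \<U> \<Longrightarrow> card T = n + 2 \<Longrightarrow> (\<Inter>U\<in>T. V U) = {}"
    using locally_finite_shrinking[OF dim \<U>(1-3)] by metis
  have small: "card S < n + 2" if "finite S" "S \<subseteq> {W \<in> V ` \<U>. x \<in> W}" for S x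
  proof (rule ccontr)
    assume "\<not> card S < n + 2"
    then obtain S' where S': "S' \<subseteq> S" "card S' = n + 2"
      using obtain_subset_with_card_n by (metis not_less)
    then have "S' \<subseteq> V ` \<U>" using \<open>S \<subseteq> _\<close> by blast
    then obtain T where T: "T \<subseteq> \<U>" "inj_on V T" "S' = V ` T" unfolding subset_image_inj by blast
    then have "(\<Inter>U\<in>T. V U) = {}" using V(4) S'(2) by (metis card_image)
    moreover have "x \<in> V U" if "U \<in> T" for U using that T(3) S'(1) \<open>S \<subseteq> _\<close> by blast
    ultimately show False by blast
  qed
  show thesis
  proof
    show "locally_finite_in X (V ` \<U>)" using locally_finite_in_refinement[OF \<U>(1)] V(2) by blast
    show "openin X W" if "W \<in> V ` \<U>" for W using that V(1) by blast
    show "\<Union>(V ` \<U>) = topspace X" using V(3) .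
    show "\<exists>C\<in>\<C>. W \<subseteq> C" if "W \<in> V ` \<U>" for W using that V(2) \<U>(4) by (metis imageE subset_trans)
    fix x
    have fin: "finite {W \<in> V ` \<U>. x \<in> W}"
    proof (rule ccontr)
      assume "infinite {W \<in> V ` \<U>. x \<in> W}"
      then obtain S where "finite S" "card S = n + 2" "S \<subseteq> {W \<in> V ` \<U>. x \<in> W}"
        using infinite_arbitrarily_large by blast
      then show False using small by fastforce
    qed
    then show "finite {W \<in> V ` \<U>. x \<in> W} \<and> card {W \<in> V ` \<U>. x \<in> W} \<le> n + 1"
      using small[OF fin subset_refl] by simp
  qed
qed

section \<open>Trees of covers and the decomposition into zero-dimensional strata\<close>

text \<open>In a forest with levels \<open>\<U> k\<close> and parent maps \<open>p k\<close> from level \<open>k + 1\<close> to level \<open>k\<close>, the descendants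
of a node \<open>s\<close> of level \<open>k\<close> that are \<open>e\<close> generations below it.\<close>

primrec descendants :: "(nat \<Rightarrow> 'b set) \<Rightarrow> (nat \<Rightarrow> 'b \<Rightarrow> 'b) \<Rightarrow> nat \<Rightarrow> 'b \<Rightarrow> nat \<Rightarrow> 'b set" where
  "descendants \<U> p k s 0 = {s}"
| "descendants \<U> p k s (Suc e) = {t \<in> \<U> (Suc (k + e)). p (k + e) t \<in> descendants \<U> p k s e}"

text \<open>Mesh zero is expressed without a metric: every neighbourhood of a point contains all members around
the point that have sufficiently high level.\<close>

locale cover_tree =
  fixes X :: "'a topology" and n :: nat
    and \<U> :: "nat \<Rightarrow> 'a set set" and p :: "nat \<Rightarrow> 'a set \<Rightarrow> 'a set"
  assumes cover: "\<And>k. \<Union>(\<U> k) = topspace X"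
    and lf: "\<And>k. locally_finite_in X (\<U> k)"
    and parent: "\<And>k t. t \<in> \<U> (Suc k) \<Longrightarrow> p k t \<in> \<U> k"
    and closure_parent: "\<And>k t. t \<in> \<U> (Suc k) \<Longrightarrow> X closure_of t \<subseteq> p k t"
    and mesh: "\<And>x U. openin X U \<Longrightarrow> x \<in> U \<Longrightarrow> \<exists>k. \<forall>l\<ge>k. \<forall>s\<in>\<U> l. x \<in> s \<longrightarrow> s \<subseteq> U"
    and order: "\<And>k x. finite {s \<in> \<U> k. x \<in> s}" "\<And>k x. card {s \<in> \<U> k. x \<in> s} \<le> n + 1"
begin

abbreviation "desc \<equiv> descendants \<U> p"

lemma desc_in: "s \<in> \<U> k \<Longrightarrow> desc k s e \<subseteq> \<U> (k + e)"
  by (cases e) auto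

lemma desc_closure: "(\<Union>t\<in>desc k s (Suc e). X closure_of t) \<subseteq> \<Union>(desc k s e)"
  using closure_parent by fastforce

lemma desc_Suc: "desc k s (Suc e) = (\<Union>t\<in>{t \<in> \<U> (Suc k). p k t = s}. desc (Suc k) t e)"
proof (induction e)
  case (Suc e)
  have "desc k s (Suc (Suc e)) = {t \<in> \<U> (Suc (Suc k + e)). p (Suc k + e) t \<in> desc k s (Suc e)}"
    by simp
  also have "\<dots> = (\<Union>t\<in>{t \<in> \<U> (Suc k). p k t = s}. desc (Suc k) t (Suc e))"
    unfolding Suc.IH by auto
  finally show ?case .
qed auto

lemma level_cover: "\<Union>(\<U> (k + e)) = (\<Union>s\<in>\<U> k. \<Union>(desc k s e))"
proof
  show "(\<Union>s\<in>\<U> k. \<Union>(desc k s e)) \<subseteq> \<Union>(\<U> (k + e))" using desc_in by blast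
  have "\<exists>s\<in>\<U> k. t \<in> desc k s e" if "t \<in> \<U> (k + e)" for t
    using that
  proof (induction e arbitrary: t)
    case (Suc e)
    then have "p (k + e) t \<in> \<U> (k + e)" using parent by simp
    with Suc show ?case by fastforce
  qed simp
  then show "\<Union>(\<U> (k + e)) \<subseteq> (\<Union>s\<in>\<U> k. \<Union>(desc k s e))" by blast
qed

text \<open>The members of \<open>\<U> k\<close> need not be covered by their children. The cores are what remains of
them when the points are removed that some later generation of descendants leaves out.\<close>

definition core :: "nat \<Rightarrow> 'a set \<Rightarrow> 'a set" where
  "core k s = (\<Inter>e. \<Union>(desc k s e))"

lemma core_subset: "core k s \<subseteq> s"
proof -
  have "core k s \<subseteq> \<Union>(desc k s 0)" unfolding core_def by blast
  then show ?thesis by simp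
qed

lemma desc_antimono: "\<Union>(desc k s (Suc e)) \<subseteq> \<Union>(desc k s e)" if "s \<in> \<U> k"
proof -
  have "t \<subseteq> X closure_of t" if "t \<in> desc k s (Suc e)" for t
  proof -
    have "t \<in> \<U> (k + Suc e)" using desc_in[OF \<open>s \<in> \<U> k\<close>] that by blast
    then have "t \<subseteq> topspace X" using cover by blast
    then show ?thesis by (rule closure_of_subset)
  qed
  then have "\<Union>(desc k s (Suc e)) \<subseteq> (\<Union>t\<in>desc k s (Suc e). X closure_of t)" by blast
  then show ?thesis using desc_closure by (rule subset_trans)
qed

lemma desc_antimono_le: "\<Union>(desc k s e') \<subseteq> \<Union>(desc k s e)" if "s \<in> \<U> k" "e \<le> e'"
  using lift_Suc_antimono_le[of "\<lambda>e. \<Union>(desc k s e)", OF desc_antimono[OF that(1)] that(2)] .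

text \<open>The core stays the same if the descendants are replaced by their closures, because these lie in the parents. The
closures of a locally finite family have a closed union.\<close>

lemma closedin_core:
  assumes s: "s \<in> \<U> k"
  shows "closedin X (core k s)"
proof -
  have "core k s = (\<Inter>e. \<Union>t\<in>desc k s (Suc e). X closure_of t)"
  proof
    show "(\<Inter>e. \<Union>t\<in>desc k s (Suc e). X closure_of t) \<subseteq> core k s"
      unfolding core_def by (rule INF_mono) (use desc_closure in blast)
    have "\<Union>(desc k s (Suc e)) \<subseteq> (\<Union>t\<in>desc k s (Suc e). X closure_of t)" for e
    proof (rule Union_least)
      fix t assume t: "t \<in> desc k s (Suc e)"
      then have "t \<subseteq> topspace X" using desc_in[OF s, of "Suc e"] cover[of "k + Suc e"] by blast
      then show "t \<subseteq> (\<Union>t\<in>desc k s (Suc e). X closure_of t)" using t closure_of_subset[of t X] by blast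
    qed
    then show "core k s \<subseteq> (\<Inter>e. \<Union>t\<in>desc k s (Suc e). X closure_of t)"
      unfolding core_def by (intro INF_greatest) (meson INF_lower UNIV_I subset_trans)
  qed
  moreover have "closedin X (\<Union>t\<in>desc k s (Suc e). X closure_of t)" for e
  proof -
    have "locally_finite_in X (desc k s (Suc e))"
      using locally_finite_in_subset[OF lf desc_in[OF s]] .
    then show ?thesis by (rule closedin_Union_locally_finite_closure)
  qed
  ultimately show ?thesis by (metis (no_types, lifting) closedin_Inter UNIV_not_empty image_is_empty imageE)
qed

text \<open>Koenig's lemma for one branching: since only finitely many \<open>s\<close> qualify at the start, one of them
qualifies for infinitely many \<open>e\<close>, and by monotonicity for all.\<close>

lemma descending_pigeonhole:
  assumes S: "finite {s \<in> S. x \<in> B s 0}"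
    and anti: "\<And>s e e'. s \<in> S \<Longrightarrow> e \<le> e' \<Longrightarrow> B s e' \<subseteq> B s e"
    and ex: "\<And>e::nat. \<exists>s\<in>S. x \<in> B s e"
  shows "\<exists>s\<in>S. \<forall>e. x \<in> B s e"
proof -
  have "\<exists>f. \<forall>e. f e \<in> {s \<in> S. x \<in> B s 0} \<and> x \<in> B (f e) e"
    using ex anti[of _ 0] by (intro choice) blast
  then obtain f where f: "\<And>e. f e \<in> {s \<in> S. x \<in> B s 0}" "\<And>e. x \<in> B (f e) e" by blast
  have "finite (range f)" using f(1) S by (meson finite_subset image_subset_iff)
  then obtain e0 where inf: "infinite {e. f e = f e0}"
    using pigeonhole_infinite[of "UNIV :: nat set" f] by auto
  have "x \<in> B (f e0) e" for e
  proof -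
    obtain e' where "e' \<ge> e" "f e' = f e0" using inf unfolding infinite_nat_iff_unbounded_le by blast
    then show ?thesis using f(2)[of e'] f(1)[of e0] anti[of "f e0" e e'] by auto
  qed
  then show ?thesis using f(1)[of e0] by blast
qed

lemma core_cover: "(\<Union>s\<in>\<U> k. core k s) = topspace X"
proof
  show "(\<Union>s\<in>\<U> k. core k s) \<subseteq> topspace X" using core_subset cover by blast
  show "topspace X \<subseteq> (\<Union>s\<in>\<U> k. core k s)"
  proof
    fix x assume x: "x \<in> topspace X"
    have "\<exists>s\<in>\<U> k. \<forall>e. x \<in> \<Union>(desc k s e)"
    proof (rule descending_pigeonhole)
      show "finite {s \<in> \<U> k. x \<in> \<Union>(desc k s 0)}" using order(1) by simp
      show "\<exists>s\<in>\<U> k. x \<in> \<Union>(desc k s e)" for e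
        using x cover[of "k + e"] unfolding level_cover by blast
    qed (rule desc_antimono_le)
    then show "x \<in> (\<Union>s\<in>\<U> k. core k s)" unfolding core_def by blast
  qed
qed

lemma core_children:
  assumes s: "s \<in> \<U> k"
  shows "core k s = (\<Union>t\<in>{t \<in> \<U> (Suc k). p k t = s}. core (Suc k) t)"
proof
  show "(\<Union>t\<in>{t \<in> \<U> (Suc k). p k t = s}. core (Suc k) t) \<subseteq> core k s"
  proof (rule UN_least)
    fix t assume t: "t \<in> {t \<in> \<U> (Suc k). p k t = s}"
    have "\<Union>(desc (Suc k) t e) \<subseteq> \<Union>(desc k s e)" for e
    proof -
      have "\<Union>(desc (Suc k) t e) \<subseteq> \<Union>(desc k s (Suc e))" unfolding desc_Suc using t by blast
      then show ?thesis using desc_antimono[OF s, of e] by (rule subset_trans)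
    qed
    then show "core (Suc k) t \<subseteq> core k s" unfolding core_def by (meson INF_mono UNIV_I)
  qed
  show "core k s \<subseteq> (\<Union>t\<in>{t \<in> \<U> (Suc k). p k t = s}. core (Suc k) t)"
  proof
    fix x assume x: "x \<in> core k s"
    let ?S = "{t \<in> \<U> (Suc k). p k t = s}"
    have "\<exists>t\<in>?S. \<forall>e. x \<in> \<Union>(desc (Suc k) t e)"
    proof (rule descending_pigeonhole)
      show "finite {t \<in> ?S. x \<in> \<Union>(desc (Suc k) t 0)}"
        by (rule finite_subset[OF _ order(1)[of "Suc k" x]]) auto
      show "\<exists>t\<in>?S. x \<in> \<Union>(desc (Suc k) t e)" for e
      proof -
        have "x \<in> \<Union>(desc k s (Suc e))" using x unfolding core_def by blast
        then show ?thesis unfolding desc_Suc by blast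
      qed
      show "\<Union>(desc (Suc k) t e') \<subseteq> \<Union>(desc (Suc k) t e)" if "t \<in> ?S" "e \<le> e'" for t e e'
        using desc_antimono_le that by blast
    qed
    then show "x \<in> (\<Union>t\<in>?S. core (Suc k) t)" unfolding core_def by blast
  qed
qed

definition members :: "nat \<Rightarrow> 'a \<Rightarrow> 'a set set" where
  "members k x = {s \<in> \<U> k. x \<in> core k s}"

lemma members_sub: "members k x \<subseteq> {s \<in> \<U> k. x \<in> s}"
  unfolding members_def using core_subset by blast

lemma finite_members: "finite (members k x)"
  using members_sub order(1) finite_subset by metis

lemma card_members_le: "card (members k x) \<le> n + 1"
  using card_mono[OF order(1) members_sub] order(2) le_trans by blast

text \<open>The cores of level \<open>k\<close> around \<open>x\<close> are the parents of those of level \<open>k + 1\<close>, so their number cannot decrease with the level.\<close>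

lemma members_Suc: "members k x = p k ` members (Suc k) x"
proof
  show "members k x \<subseteq> p k ` members (Suc k) x"
  proof
    fix s assume "s \<in> members k x"
    then have "s \<in> \<U> k" "x \<in> core k s" unfolding members_def by auto
    then obtain t where "t \<in> \<U> (Suc k)" "p k t = s" "x \<in> core (Suc k) t"
      using core_children[of s k] by auto
    then show "s \<in> p k ` members (Suc k) x" unfolding members_def by blast
  qed
  show "p k ` members (Suc k) x \<subseteq> members k x"
  proof
    fix s assume "s \<in> p k ` members (Suc k) x"
    then obtain t where t: "t \<in> \<U> (Suc k)" "x \<in> core (Suc k) t" "s = p k t"
      unfolding members_def by blast
    then have s: "s \<in> \<U> k" using parent by simp
    have "x \<in> core k s" unfolding core_children[OF s] using t by blast
    with s show "s \<in> members k x" unfolding members_def by blast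
  qed
qed

lemma card_members_mono: "k \<le> l \<Longrightarrow> card (members k x) \<le> card (members l x)"
proof (rule lift_Suc_mono_le[of "\<lambda>k. card (members k x)"])
  show "card (members k x) \<le> card (members (Suc k) x)" for k
    unfolding members_Suc[of k x] by (rule card_image_le[OF finite_members])
qed

lemma members_nonempty: "x \<in> topspace X \<Longrightarrow> members k x \<noteq> {}"
  using core_cover[of k] unfolding members_def by blast

text \<open>Close to \<open>x\<close> there are only finitely many cores of level \<open>k\<close>, and those that miss \<open>x\<close> are closed.\<close>

lemma members_upper:
  assumes x: "x \<in> topspace X"
  shows "\<exists>V. openin X V \<and> x \<in> V \<and> (\<forall>y\<in>V. members k y \<subseteq> members k x)"
proof -
  obtain V where V: "openin X V" "x \<in> V" "finite {s \<in> \<U> k. s \<inter> V \<noteq> {}}"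
    using lf[of k] x unfolding locally_finite_in_def by blast
  define F where "F = (\<Union>s\<in>{s \<in> \<U> k. s \<inter> V \<noteq> {} \<and> x \<notin> core k s}. core k s)"
  have "finite {s \<in> \<U> k. s \<inter> V \<noteq> {} \<and> x \<notin> core k s}"
    by (rule finite_subset[OF _ V(3)]) blast
  then have "closedin X F"
    unfolding F_def by (intro closedin_Union) (auto intro: closedin_core)
  then have "openin X (V - F)" using V(1) by blast
  moreover have "x \<in> V - F" using V(2) unfolding F_def by blast
  moreover have "members k y \<subseteq> members k x" if y: "y \<in> V - F" for y
  proof
    fix s assume s: "s \<in> members k y"
    then have "s \<inter> V \<noteq> {}" "s \<in> \<U> k" "y \<in> core k s"
      using members_sub y unfolding members_def by blast+
    then show "s \<in> members k x" using y unfolding F_def members_def by blast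
  qed
  ultimately show ?thesis by blast
qed

text \<open>The points around which the number of cores grows to the limit \<open>j\<close>.\<close>

definition stratum :: "nat \<Rightarrow> 'a set" where
  "stratum j = {x \<in> topspace X. (\<forall>k. card (members k x) \<le> j) \<and> (\<exists>k. card (members k x) = j)}"

lemma strata_cover: "topspace X \<subseteq> (\<Union>j\<in>{1..n+1}. stratum j)"
proof
  fix x assume x: "x \<in> topspace X"
  have "\<exists>k. k \<in> UNIV \<and> (\<forall>l. l \<in> UNIV \<longrightarrow> card (members l x) \<le> card (members k x))"
    by (rule ex_has_greatest_nat[where b = "n + 2" and k = 0])
       (use card_members_le in \<open>auto simp: less_Suc_eq_le\<close>)
  then obtain k where k: "\<And>l. card (members l x) \<le> card (members k x)" by blast
  then have "x \<in> stratum (card (members k x))" unfolding stratum_def using x by blast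
  moreover have "card (members k x) \<ge> 1"
    using members_nonempty[OF x, of k] finite_members[of k x] by (simp add: Suc_le_eq card_gt_0_iff)
  ultimately show "x \<in> (\<Union>j\<in>{1..n+1}. stratum j)" using card_members_le[of k x] by auto
qed

text \<open>\<open>A k\<close> is the part of the stratum on which the limit is reached at level \<open>k\<close>. There every family
\<open>members (k + l) x\<close> has exactly \<open>j\<close> elements, which turns upper semicontinuity into local constancy;
points with equal families share a member of level \<open>k + l\<close> and are close.\<close>

lemma zero_dim_in_stratum:
  assumes X: "metrizable_space X"
  shows "zero_dim_in X (stratum j)"
proof (rule zero_dim_in_subtopology)
  define Y where "Y = subtopology X (stratum j)"
  define A where "A k = {x \<in> stratum j. card (members k x) = j}" for k
  have sub: "stratum j \<subseteq> topspace X" unfolding stratum_def by blast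
  then have top: "topspace Y = stratum j" unfolding Y_def by auto
  have "closedin Y (A k)" for k
    unfolding closedin_def top
  proof
    show "A k \<subseteq> stratum j" unfolding A_def by blast
    show "openin Y (stratum j - A k)"
    proof (subst openin_subopen, rule ballI)
      fix x assume x: "x \<in> stratum j - A k"
      then have "card (members k x) \<le> j" "card (members k x) \<noteq> j"
        unfolding A_def stratum_def by auto
      then have lt: "card (members k x) < j" by simp
      obtain V where V: "openin X V" "x \<in> V" "\<And>y. y \<in> V \<Longrightarrow> members k y \<subseteq> members k x"
        using members_upper[of x k] x sub by blast
      have "card (members k y) < j" if "y \<in> V" for y
        using card_mono[OF finite_members V(3)[OF that]] lt by simp
      then have "V \<inter> stratum j \<subseteq> stratum j - A k" unfolding A_def by fastforce
      moreover have "openin Y (V \<inter> stratum j)"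
        unfolding Y_def using V(1) by (auto simp: openin_subtopology)
      ultimately show "\<exists>T. openin Y T \<and> x \<in> T \<and> T \<subseteq> stratum j - A k" using x V(2) by blast
    qed
  qed
  moreover have "zero_dim_in Y (A k)" for k
  proof (rule zero_dim_inI_labels)
    show "locally_constant_on Y (A k) (members (k + l))" for l
    proof -
      have "locally_constant_on X (A k) (members (k + l))"
        unfolding locally_constant_on_def
      proof
        fix x assume x: "x \<in> A k"
        then obtain V where V: "openin X V" "x \<in> V" "\<And>y. y \<in> V \<Longrightarrow> members (k + l) y \<subseteq> members (k + l) x"
          using members_upper[of x "k + l"] sub unfolding A_def by blast
        have "members (k + l) y = members (k + l) x" if "y \<in> V \<inter> A k" for y
        proof (rule card_seteq)
          show "members (k + l) y \<subseteq> members (k + l) x" using V(3) that by blast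
          have "card (members (k + l) x) \<le> j" using x unfolding A_def stratum_def by blast
          also have "j = card (members k y)" using that unfolding A_def by blast
          also have "\<dots> \<le> card (members (k + l) y)" by (rule card_members_mono) simp
          finally show "card (members (k + l) x) \<le> card (members (k + l) y)" .
        qed (rule finite_members)
        then show "\<exists>U. openin X U \<and> x \<in> U \<and> (\<forall>y\<in>U \<inter> A k. members (k + l) y = members (k + l) x)"
          using V(1,2) by blast
      qed
      moreover have "A k \<subseteq> stratum j" unfolding A_def by blast
      ultimately show ?thesis unfolding Y_def by (simp add: locally_constant_on_subtopology)
    qed
    fix x U assume x: "x \<in> A k" and U: "openin Y U" "x \<in> U"
    obtain W where W: "openin X W" "U = W \<inter> stratum j"
      using U(1) unfolding Y_def openin_subtopology by blast
    have "x \<in> W" using W(2) U(2) by blast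
    from mesh[OF W(1) this] obtain l where l: "\<forall>l'\<ge>l. \<forall>s\<in>\<U> l'. x \<in> s \<longrightarrow> s \<subseteq> W"
      by (rule exE)
    have "y \<in> U" if y: "y \<in> A k" "members (k + l) y = members (k + l) x" for y
    proof -
      have "x \<in> topspace X" using x sub unfolding A_def by blast
      then obtain s where s: "s \<in> members (k + l) x" using members_nonempty by blast
      then have "s \<in> \<U> (k + l)" "x \<in> s" "y \<in> s" using members_sub y(2) by blast+
      then have "y \<in> W" using l by (meson le_add2 subsetD)
      then show ?thesis using W(2) y(1) unfolding A_def by blast
    qed
    then show "\<exists>m. \<forall>y\<in>A k. (\<forall>i\<le>m. members (k + i) y = members (k + i) x) \<longrightarrow> y \<in> U"
      by (intro exI[of _ l]) simp
  qed
  moreover have "(\<Union>k. A k) = topspace Y" unfolding top A_def stratum_def by blast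
  moreover have "metrizable_space Y" unfolding Y_def by (rule metrizable_space_subtopology[OF X])
  ultimately have "zero_dim_in Y (topspace Y)" by (intro zero_dim_in_countable_sum)
  then show "zero_dim_in (subtopology X (stratum j)) (stratum j)"
    unfolding top unfolding Y_def .
qed

end

lemma refine_with_closures:
  assumes "Metric_space M d" and Xd: "X = Metric_space.mtopology M d"
    and dim: "covering_dim_le X (int n)"
    and \<U>: "\<And>U. U \<in> \<U> \<Longrightarrow> openin X U" "\<Union>\<U> = topspace X" and r: "r > 0"
  obtains \<V> where "locally_finite_in X \<V>" "\<And>V. V \<in> \<V> \<Longrightarrow> openin X V" "\<Union>\<V> = topspace X"
    "\<And>x. finite {V\<in>\<V>. x \<in> V}" "\<And>x. card {V\<in>\<V>. x \<in> V} \<le> n + 1"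
    "\<And>V. V \<in> \<V> \<Longrightarrow> \<exists>U\<in>\<U>. X closure_of V \<subseteq> U"
    "\<And>V x y. V \<in> \<V> \<Longrightarrow> x \<in> V \<Longrightarrow> y \<in> V \<Longrightarrow> d x y < r"
proof -
  interpret Metric_space M d by fact
  have X: "metrizable_space X" unfolding Xd by (rule metrizable_space_mtopology)
  define \<C> where "\<C> = {W. openin X W \<and> (\<exists>U\<in>\<U>. X closure_of W \<subseteq> U) \<and> (\<forall>y\<in>W. \<forall>z\<in>W. d y z < r)}"
  have C: "\<And>W. W \<in> \<C> \<Longrightarrow> openin X W" unfolding \<C>_def by blast
  have UC: "\<Union>\<C> = topspace X"
  proof
    show "\<Union>\<C> \<subseteq> topspace X" using C openin_subset by blast
    show "topspace X \<subseteq> \<Union>\<C>"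
    proof
      fix x assume x: "x \<in> topspace X"
      then obtain U where U: "U \<in> \<U>" "x \<in> U" using \<U>(2) by blast
      then obtain e where e: "e > 0" "mball x e \<subseteq> U"
        using \<U>(1)[OF U(1)] unfolding Xd openin_mtopology by blast
      define e' where "e' = min (e / 2) (r / 2)"
      have e': "e' > 0" "e' < e" "e' \<le> r / 2" unfolding e'_def using e(1) r by auto
      have "mcball x e' \<subseteq> mball x e" using e'(2) by (auto)
      moreover have "X closure_of (mball x e') \<subseteq> mcball x e'"
        unfolding Xd by (rule closure_of_minimal) auto
      ultimately have "X closure_of (mball x e') \<subseteq> U" using e(2) by blast
      moreover have "d y z < r" if "y \<in> mball x e'" "z \<in> mball x e'" for y z
        using that triangle''[of y x z] e'(3) by auto
      ultimately have "mball x e' \<in> \<C>" unfolding \<C>_def Xd using U(1) by blast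
      moreover have "x \<in> mball x e'" using x e'(1) unfolding Xd by simp
      ultimately show "x \<in> \<Union>\<C>" by blast
    qed
  qed
  show thesis
  proof (rule metrizable_dim_refinement[OF X dim C UC])
    fix \<V> assume \<V>: "locally_finite_in X \<V>" "\<And>V. V \<in> \<V> \<Longrightarrow> openin X V" "\<Union>\<V> = topspace X"
      "\<And>V. V \<in> \<V> \<Longrightarrow> \<exists>C\<in>\<C>. V \<subseteq> C"
      "\<And>x. finite {V\<in>\<V>. x \<in> V} \<and> card {V\<in>\<V>. x \<in> V} \<le> n + 1"
    show thesis
    proof (rule that[OF \<V>(1-3)])
      fix V assume "V \<in> \<V>"
      then obtain C where C: "C \<in> \<C>" "V \<subseteq> C" using \<V>(4) by blast
      then show "\<exists>U\<in>\<U>. X closure_of V \<subseteq> U"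
        unfolding \<C>_def using closure_of_mono[OF C(2), of X] by blast
      show "d x y < r" if "x \<in> V" "y \<in> V" for x y using that C unfolding \<C>_def by blast
    qed (use \<V>(5) in auto)
  qed
qed

text \<open>Every level refines the family of small open sets whose closure lies in a member of the previous level; this supplies the parents.\<close>

lemma exists_cover_tree:
  assumes X: "metrizable_space X" and dim: "covering_dim_le X (int n)"
  obtains \<U> p where "cover_tree X n \<U> p"
proof -
  obtain M d where Md: "Metric_space M d" and Xd: "X = Metric_space.mtopology M d"
    using X unfolding metrizable_space_def by blast
  interpret Metric_space M d by fact
  define P where "P k \<V> \<longleftrightarrow> locally_finite_in X \<V> \<and> (\<forall>V\<in>\<V>. openin X V) \<and> \<Union>\<V> = topspace X \<and>
      (\<forall>x. finite {V\<in>\<V>. x \<in> V}) \<and> (\<forall>x. card {V\<in>\<V>. x \<in> V} \<le> n + 1) \<and>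
      (\<forall>V\<in>\<V>. \<forall>x\<in>V. \<forall>y\<in>V. d x y < inverse (real (Suc k)))" for k \<V>
  define Q where "Q \<U> \<V> \<longleftrightarrow> (\<forall>V\<in>\<V>. \<exists>U\<in>\<U>. X closure_of V \<subseteq> U)" for \<U> \<V>
  have step: "\<exists>\<V>. P k \<V> \<and> Q \<U> \<V>" if "\<And>U. U \<in> \<U> \<Longrightarrow> openin X U" "\<Union>\<U> = topspace X" for k \<U>
  proof -
    have r: "0 < inverse (real (Suc k))" by simp
    show ?thesis
    proof (rule refine_with_closures[OF Md Xd dim that r])
      fix \<V> assume "locally_finite_in X \<V>" "\<And>V. V \<in> \<V> \<Longrightarrow> openin X V" "\<Union>\<V> = topspace X"
        "\<And>x. finite {V\<in>\<V>. x \<in> V}" "\<And>x. card {V\<in>\<V>. x \<in> V} \<le> n + 1"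
        "\<And>V. V \<in> \<V> \<Longrightarrow> \<exists>U\<in>\<U>. X closure_of V \<subseteq> U"
        "\<And>V x y. V \<in> \<V> \<Longrightarrow> x \<in> V \<Longrightarrow> y \<in> V \<Longrightarrow> d x y < inverse (real (Suc k))"
      then show ?thesis unfolding P_def Q_def by (intro exI[of _ \<V>]) simp
    qed
  qed
  have "\<exists>\<U>. \<forall>k. P k (\<U> k) \<and> Q (\<U> k) (\<U> (Suc k))"
  proof (rule dependent_nat_choice)
    show "\<exists>\<V>. P 0 \<V>" using step[of "{topspace X}" 0] by auto
    show "\<exists>\<V>. P (Suc k) \<V> \<and> Q \<U> \<V>" if "P k \<U>" for \<U> k
      using step[of \<U> "Suc k"] that unfolding P_def by blast
  qed
  then obtain \<U> where \<U>: "\<And>k. P k (\<U> k)" "\<And>k. Q (\<U> k) (\<U> (Suc k))" by blast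
  have "\<forall>k t. \<exists>u. t \<in> \<U> (Suc k) \<longrightarrow> u \<in> \<U> k \<and> X closure_of t \<subseteq> u"
    using \<U>(2) unfolding Q_def by blast
  then obtain p where p: "\<And>k t. t \<in> \<U> (Suc k) \<Longrightarrow> p k t \<in> \<U> k \<and> X closure_of t \<subseteq> p k t" by metis
  have "cover_tree X n \<U> p"
  proof
    fix x U assume U: "openin X U" "x \<in> U"
    then obtain r where r: "r > 0" "mball x r \<subseteq> U" "x \<in> M" unfolding Xd openin_mtopology by blast
    obtain k where k: "inverse (real (Suc k)) < r" using reals_Archimedean[OF r(1)] by blast
    have "s \<subseteq> U" if "l \<ge> k" "s \<in> \<U> l" "x \<in> s" for l s
    proof
      fix y assume y: "y \<in> s"
      have "d x y < inverse (real (Suc l))" using \<U>(1)[of l] that y unfolding P_def by blast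
      also have "\<dots> \<le> inverse (real (Suc k))" using that(1) by (simp add: le_imp_inverse_le)
      finally have "d x y < r" using k by simp
      moreover have "y \<in> M"
        using \<U>(1)[of l] that(2) y openin_subset[of X s] unfolding P_def Xd by auto
      ultimately show "y \<in> U" using r by auto
    qed
    then show "\<exists>k. \<forall>l\<ge>k. \<forall>s\<in>\<U> l. x \<in> s \<longrightarrow> s \<subseteq> U" by blast
  qed (use p \<U>(1) in \<open>auto simp: P_def\<close>)
  then show thesis by (rule that)
qed

section \<open>Structural numbers and the theorem\<close>

lemma structural_number_ge_1:
  fixes X :: "'a topology"
  assumes "structural_family \<A> X (J :: 'a topology set) S"
  shows "xcard_le (xcard_of_nat 1) (structural_number \<A> X)"
proof (rule structural_number_Some[OF assms])
  fix I T assume fam: "structural_family \<A> X I T" and eq: "structural_number \<A> X = Some |I|"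
  obtain i where "i \<in> I" using fam unfolding structural_family_def by blast
  then have "|{..<1::nat}| \<le>o |I|"
    by (intro card_of_ordLeqI[of "\<lambda>_. i"]) (auto simp: inj_on_def)
  then show ?thesis by (simp add: eq xcard_le_def xcard_of_nat_def)
qed

text \<open>The intersection of a family with one member is that member, so it would be \<open>X\<close> itself.\<close>

lemma structural_number_ge_2:
  fixes X :: "'a topology"
  assumes "structural_family \<A> X (J :: 'a topology set) S" and X: "\<not> \<A> X"
  shows "xcard_le (xcard_of_nat 2) (structural_number \<A> X)"
proof (rule structural_number_Some[OF assms(1)])
  fix I T assume fam: "structural_family \<A> X I T" and eq: "structural_number \<A> X = Some |I|"
  obtain i where i: "i \<in> I" using fam unfolding structural_family_def by blast
  have "I \<noteq> {i}"
  proof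
    assume I: "I = {i}"
    then have "Collect (openin X) = Collect (openin (T i))"
      using fam unfolding structural_family_def by simp
    then have "X = T i" by (simp add: topology_eq set_eq_iff)
    then show False using X fam i unfolding structural_family_def by auto
  qed
  then obtain j where j: "j \<in> I" "j \<noteq> i" using i by blast
  have "|{..<2::nat}| \<le>o |I|"
    by (rule card_of_ordLeqI[of "\<lambda>k. if k = 0 then i else j"])
       (use i j in \<open>auto simp: inj_on_def less_2_cases_iff\<close>)
  then show ?thesis by (simp add: eq xcard_le_def xcard_of_nat_def)
qed

theorem theorem4p4:
  fixes X :: "'a topology" and n :: nat
  assumes "metrizable_space X"
    and "covering_dim X = ereal (real n)"
  shows "(\<exists>M :: nat \<Rightarrow> 'a set.
            (\<forall>i\<in>{1..n+1}. M i \<subseteq> topspace X) \<and>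
            Collect (openin X) = (\<Inter>i\<in>{1..n+1}. Collect (openin (discretize_off X (M i)))) \<and>
            (\<forall>i\<in>{1..n+1}. metrizable_space (discretize_off X (M i)) \<and>
                          covering_dim (discretize_off X (M i)) = 0)) \<and>
         xcard_le (xcard_of_nat 1) (structural_number M_dim X) \<and>
         xcard_le (structural_number M_dim X) (xcard_of_nat (n + 1)) \<and>
         (covering_dim X \<ge> 1 \<longrightarrow>
            xcard_le (xcard_of_nat 2) (structural_number M_dim X) \<and>
            xcard_le (structural_number M_dim X) (xcard_of_nat (n + 1)))"
proof -
  have "covering_dim X = ereal (of_int (int n))" using assms(2) by simp
  then have dim: "covering_dim_le X (int n)" and ndim: "\<not> covering_dim_le X (int n - 1)"
    using covering_dim_eq_iff by blast+
  have nonempty: "topspace X \<noteq> {}"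
  proof
    assume "topspace X = {}"
    then have "covering_dim_le X (- 1)" by (simp add: covering_dim_le_def)
    then show False using ndim covering_dim_le_mono[of X "- 1" "int n - 1"] by simp
  qed
  obtain \<U> p where "cover_tree X n \<U> p" using exists_cover_tree[OF assms(1) dim] by blast
  then interpret cover_tree X n \<U> p .
  have "\<exists>M. stratum j \<subseteq> M \<and> M \<subseteq> topspace X \<and> metrizable_space (discretize_off X M) \<and>
          covering_dim (discretize_off X M) = 0" for j
  proof -
    have "stratum j \<subseteq> topspace X" unfolding stratum_def by blast
    then obtain M where "stratum j \<subseteq> M" "M \<subseteq> topspace X" "metrizable_space (discretize_off X M)"
      "zero_dim_in (discretize_off X M) (topspace X)"
      using zero_dim_in_enlarge[OF assms(1) zero_dim_in_stratum[OF assms(1)]] by metis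
    then show ?thesis
      using zero_dim_in_imp_covering_dim[of "discretize_off X M"] nonempty by auto
  qed
  then obtain M where M: "\<And>j. stratum j \<subseteq> M j" "\<And>j. M j \<subseteq> topspace X"
    "\<And>j. metrizable_space (discretize_off X (M j))" "\<And>j. covering_dim (discretize_off X (M j)) = 0"
    by metis
  have "topspace X \<subseteq> (\<Union>j\<in>{1..n+1}. M j)" using strata_cover M(1) by blast
  then have Int: "Collect (openin X) = (\<Inter>i\<in>{1..n+1}. Collect (openin (discretize_off X (M i))))"
    by (intro Inter_discretize_off) auto
  have fam: "structural_family M_dim X {1..n+1} (\<lambda>i. discretize_off X (M i))"
    unfolding structural_family_def
  proof (intro conjI ballI)
    show "Collect (openin X) \<subseteq> Collect (openin (discretize_off X (M i)))" for i
      unfolding openin_discretize_off by blast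
  qed (use Int M(3,4) in \<open>auto simp: M_dim_def\<close>)
  then have fam': "structural_family M_dim X ((\<lambda>i. discretize_off X (M i)) ` {1..n+1}) id"
    unfolding structural_family_def by auto
  \<comment> \<open>The families are indexed by \<open>{1..n+1}\<close>, the cardinal \<open>n + 1\<close> is represented by \<open>{..<n+1}\<close>.\<close>
  have "|{1..n+1}| \<le>o |{..<n+1}|"
    by (rule card_of_ordLeqI[of "\<lambda>i. i - 1"]) (auto simp: inj_on_def)
  then have le: "xcard_le (structural_number M_dim X) (xcard_of_nat (n + 1))"
    using structural_number_le[OF fam] unfolding xcard_le_def xcard_of_nat_def
    by (auto split: option.splits intro: ordLeq_transitive)
  have "xcard_le (xcard_of_nat 2) (structural_number M_dim X)" if "covering_dim X \<ge> 1"
    using structural_number_ge_2[OF fam'] that unfolding M_dim_def by fastforce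
  moreover have "\<exists>M :: nat \<Rightarrow> 'a set.
            (\<forall>i\<in>{1..n+1}. M i \<subseteq> topspace X) \<and>
            Collect (openin X) = (\<Inter>i\<in>{1..n+1}. Collect (openin (discretize_off X (M i)))) \<and>
            (\<forall>i\<in>{1..n+1}. metrizable_space (discretize_off X (M i)) \<and>
                          covering_dim (discretize_off X (M i)) = 0)"
    by (intro exI[of _ M] conjI ballI M Int)
  ultimately show ?thesis using le structural_number_ge_1[OF fam'] by simp
qed

end
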